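(* If $n$ is a product of $2$, $3$, or $4$ pairwise distinct primes, then the $n\times n$ square has no perfect Mondrian partition.
   Context: A Mondrian partition of an $n\times n$ square ($n$ a positive integer) is a dissection of the square into $k\ge 2$ non-overlapping rectangles with positive integer side lengths which are pairwise non-congruent (rectangles of dimensions $a\times b$ and $b\times a$ count as congruent). It is perfect if all its rectangles have the same area. *)

theory Defs
  imports Complex_Main "HOL-Computational_Algebra.Primes"
begin

text \<open>A rectangle is given by its lower-left corner (a,b) (real coordinates) and
its integer width w and height h; it denotes a closed axis-parallel rectangle
in the plane.\<close>

type_synonym rect = "real \<times> real \<times> nat \<times> nat"

definition rect_set :: "rect \<Rightarrow> (real \<times> real) set" where
  "rect_set r = (case r of (a, b, w, h) \<Rightarrow>
     {(x, y). a \<le> x \<and> x \<le> a + real w \<and> b \<le> y \<and> y \<le> b + real h})"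

definition rect_interior :: "rect \<Rightarrow> (real \<times> real) set" where
  "rect_interior r = (case r of (a, b, w, h) \<Rightarrow>
     {(x, y). a < x \<and> x < a + real w \<and> b < y \<and> y < b + real h})"

definition rect_width :: "rect \<Rightarrow> nat" where
  "rect_width r = fst (snd (snd r))"

definition rect_height :: "rect \<Rightarrow> nat" where
  "rect_height r = snd (snd (snd r))"

definition rect_area :: "rect \<Rightarrow> nat" where
  "rect_area r = rect_width r * rect_height r"

definition congruent_rect :: "rect \<Rightarrow> rect \<Rightarrow> bool" where
  "congruent_rect r s \<longleftrightarrow>
     (rect_width r = rect_width s \<and> rect_height r = rect_height s) \<or>
     (rect_width r = rect_height s \<and> rect_height r = rect_width s)"

definition mondrian_partition :: "nat \<Rightarrow> rect set \<Rightarrow> bool" where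
  "mondrian_partition n P \<longleftrightarrow>
     finite P \<and> card P \<ge> 2 \<and>
     (\<forall>r\<in>P. rect_width r > 0 \<and> rect_height r > 0) \<and>
     (\<Union>r\<in>P. rect_set r) = {(x, y). 0 \<le> x \<and> x \<le> real n \<and> 0 \<le> y \<and> y \<le> real n} \<and>
     (\<forall>r\<in>P. \<forall>s\<in>P. r \<noteq> s \<longrightarrow> rect_interior r \<inter> rect_interior s = {}) \<and>
     (\<forall>r\<in>P. \<forall>s\<in>P. r \<noteq> s \<longrightarrow> \<not> congruent_rect r s)"

definition perfect_mondrian_partition :: "nat \<Rightarrow> rect set \<Rightarrow> bool" where
  "perfect_mondrian_partition n P \<longleftrightarrow>
     mondrian_partition n P \<and> (\<forall>r\<in>P. \<forall>s\<in>P. rect_area r = rect_area s)"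

end

theory Submission
  imports Defs "HOL-Analysis.Analysis"
begin

text \<open>
  Let \<open>k\<close> be the number of tiles and \<open>A\<close> their area, so \<open>k A = n\<^sup>2\<close>. Up to five tiles are excluded
  geometrically: a tiling by two to four rectangles of equal area contains two congruent ones, and five tiles
  form a pinwheel. For \<open>k \<ge> 6\<close> one counts factorisations \<open>A = x y\<close> with \<open>x, y \<le> n\<close>, of which at least
  \<open>k\<close> are needed. If a prime \<open>p\<close> divides \<open>A\<close> exactly once, every tile has a unique side prime to \<open>p\<close>, and
  in the essential case \<open>k = p\<close>, \<open>n = p M\<close>, these sides are divisors of \<open>M\<^sup>2\<close> between \<open>M\<close> and
  \<open>(p - 1) M\<close> because a row can only be completed by sides of length at least \<open>M\<close>. Only finitely many
  \<open>n\<close> pass this count, namely 210, 330, 462, 546, 714, 770 and 910, and for these one examines how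
  a row or column through a long tile can be completed to length \<open>n\<close>.
\<close>

section \<open>Rows and columns of a tiling\<close>

text \<open>Since \<open>k A = n^2\<close> and \<open>n\<close> is squarefree, its primes split into
  sets \<open>T\<close>, \<open>U\<close>, \<open>V\<close> dividing \<open>k\<close> once, twice
  and not at all: \<open>k\<close> is the product of \<open>T\<close> times the squared product of
  \<open>U\<close>, and \<open>A\<close> is the product of \<open>T\<close> times
  \<open>M^2\<close>, where \<open>M\<close> is the product of \<open>V\<close>. A side length
  determines its tile, so every rule that picks one side per tile injects the tiles into the
  divisors allowed for that side. For nonempty \<open>T\<close> this gives
  \<open>k <= 2^(|T|-1) 3^|V|\<close>, while \<open>k >= (|T|+|U|+1)!\<close>. With at most four
  primes, these bounds and the fact that sides are not too short leave \<open>k = p\<close>,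
  \<open>k = P Q\<close> and, for empty \<open>T\<close>, \<open>k = 9\<close>, where the longer
  side replaces the side prime to \<open>p\<close>. The obstacle is that the primes themselves are
  still unbounded and plain divisor counts ignore size. A side is therefore recorded by its quotient
  with \<open>M\<close>, a fraction \<open>x/y\<close> in the unknown primes. Each candidate becomes
  a 0/1 term deciding an inequality between these primes, and the demand that at least
  \<open>k\<close> terms be 1 bounds them.\<close>

text \<open>Every horizontal line in general position meets a set \<open>R\<close> of tiles (a row), and \<open>\<mu> R\<close> is the total
  length of the heights at which the row is \<open>R\<close>; \<open>\<nu>\<close> does the same for columns. This remembers just
  enough of the geometry, and is stable under exchanging rows with columns and removing full strips.\<close>
locale equal_area_tiling =
  fixes F :: "'a set" and w h :: "'a \<Rightarrow> nat" and A a c :: nat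
    and \<mu> \<nu> :: "'a set \<Rightarrow> real"
  assumes finite_tiles: "finite F"
    and area: "r \<in> F \<Longrightarrow> w r * h r = A"
    and area_pos: "0 < A"
    and incongruent: "r \<in> F \<Longrightarrow> s \<in> F \<Longrightarrow> w r = w s \<or> w r = h s \<Longrightarrow> r = s"
    and row_nonneg: "0 \<le> \<mu> R"
    and col_nonneg: "0 \<le> \<nu> C"
    and row_subset: "\<mu> R \<noteq> 0 \<Longrightarrow> R \<subseteq> F"
    and col_subset: "\<nu> C \<noteq> 0 \<Longrightarrow> C \<subseteq> F"
    and row_sum: "\<mu> R \<noteq> 0 \<Longrightarrow> sum w R = a"
    and col_sum: "\<nu> C \<noteq> 0 \<Longrightarrow> sum h C = c"
    and row_total: "(\<Sum>R\<in>Pow F. \<mu> R) = real c"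
    and col_total: "(\<Sum>C\<in>Pow F. \<nu> C) = real a"
    and row_tile: "r \<in> F \<Longrightarrow> (\<Sum>R | R \<subseteq> F \<and> r \<in> R. \<mu> R) = real (h r)"
    and col_tile: "r \<in> F \<Longrightarrow> (\<Sum>C | C \<subseteq> F \<and> r \<in> C. \<nu> C) = real (w r)"
    and cross: "\<mu> R \<noteq> 0 \<Longrightarrow> \<nu> C \<noteq> 0 \<Longrightarrow> r \<in> R \<Longrightarrow> s \<in> R \<Longrightarrow> r \<in> C \<Longrightarrow> s \<in> C \<Longrightarrow> r = s"
begin

lemma w_pos: "r \<in> F \<Longrightarrow> 0 < w r" and h_pos: "r \<in> F \<Longrightarrow> 0 < h r"
  using area area_pos by (metis mult_is_0 neq0_conv)+

lemma incongruent_h: "r \<in> F \<Longrightarrow> s \<in> F \<Longrightarrow> h r = h s \<or> h r = w s \<Longrightarrow> r = s"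
proof -
  assume rs: "r \<in> F" "s \<in> F" "h r = h s \<or> h r = w s"
  then have "w r * h r = w s * h s" "h r > 0" using area h_pos by auto
  then have "w r = w s \<or> w r = h s" using rs(3) by (auto simp: mult.commute)
  then show "r = s" using incongruent rs by blast
qed

text \<open>Congruence is excluded up to rotation, so either side of a tile identifies it. Every
  counting bound for \<open>card F\<close> rests on this, with the shorter side, the longer side or
  the side prime to \<open>p\<close>.\<close>

lemma inj_on_side:
  assumes "\<And>r. r \<in> F \<Longrightarrow> f r = w r \<or> f r = h r"
  shows "inj_on f F"
proof (rule inj_onI)
  fix r s assume rs: "r \<in> F" "s \<in> F" "f r = f s"
  then have "w r = w s \<or> w r = h s \<or> h r = w s \<or> h r = h s" using assms by metis
  then show "r = s" using incongruent[of r s] incongruent_h[of r s] rs by blast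
qed

text \<open>The axioms are symmetric in rows and columns, so each result on rows and widths is
  reused for columns and heights.\<close>

lemma dual: "equal_area_tiling F h w A c a \<nu> \<mu>"
proof
  show "h r * w r = A" if "r \<in> F" for r using area[OF that] by (simp add: mult.commute)
qed (rule finite_tiles area_pos incongruent_h row_nonneg col_nonneg row_subset col_subset
    row_sum col_sum row_total col_total row_tile col_tile cross; assumption)+

lemma fin_Pow: "finite {R. R \<subseteq> F \<and> Q R}"
  using finite_tiles by simp

lemma finite_row: "\<mu> R \<noteq> 0 \<Longrightarrow> finite R"
  using row_subset finite_tiles finite_subset by blast

lemma row_exists: assumes "r \<in> F" shows "\<exists>R. \<mu> R \<noteq> 0 \<and> r \<in> R"
proof -
  have "(\<Sum>R | R \<subseteq> F \<and> r \<in> R. \<mu> R) \<noteq> 0"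
    using row_tile[OF assms] h_pos[OF assms] by simp
  then obtain R where "R \<in> {R. R \<subseteq> F \<and> r \<in> R}" "\<mu> R \<noteq> 0"
    by (rule sum.not_neutral_contains_not_neutral)
  then show ?thesis by blast
qed

text \<open>The height of a tile is the total weight of the rows through it. The contrapositive is
  what matters: of two tiles, the taller one lies in a row that avoids the other.\<close>

lemma row_contained_le:
  assumes "r \<in> F" "s \<in> F" and "\<And>R. \<mu> R \<noteq> 0 \<Longrightarrow> r \<in> R \<Longrightarrow> s \<in> R"
  shows "h r \<le> h s"
proof -
  have "real (h r) = (\<Sum>R | R \<subseteq> F \<and> r \<in> R. \<mu> R)" using row_tile assms by simp
  also have "\<dots> = (\<Sum>R | R \<subseteq> F \<and> r \<in> R \<and> s \<in> R. \<mu> R)"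
    by (rule sum.mono_neutral_right) (use assms fin_Pow in auto)
  also have "\<dots> \<le> (\<Sum>R | R \<subseteq> F \<and> s \<in> R. \<mu> R)"
    by (rule sum_mono2) (use fin_Pow row_nonneg in auto)
  also have "\<dots> = h s" using row_tile assms by simp
  finally show ?thesis by simp
qed

lemma row_partition:
  assumes "r \<in> F" "s \<in> F" and "\<And>R. \<mu> R \<noteq> 0 \<Longrightarrow> (r \<in> R) \<noteq> (s \<in> R)"
  shows "h r + h s = c"
proof -
  have "real c = (\<Sum>R | R \<subseteq> F. \<mu> R)" using row_total by (simp add: Pow_def)
  also have "\<dots> = (\<Sum>R\<in>{R. R \<subseteq> F \<and> r \<in> R} \<union> {R. R \<subseteq> F \<and> r \<notin> R}. \<mu> R)"
    by (rule sum.cong) auto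
  also have "\<dots> = (\<Sum>R | R \<subseteq> F \<and> r \<in> R. \<mu> R) + (\<Sum>R | R \<subseteq> F \<and> r \<notin> R. \<mu> R)"
    by (rule sum.union_disjoint) (use fin_Pow in auto)
  also have "(\<Sum>R | R \<subseteq> F \<and> r \<notin> R. \<mu> R) = (\<Sum>R | R \<subseteq> F \<and> r \<notin> R \<and> s \<in> R. \<mu> R)"
    by (rule sum.mono_neutral_right) (use assms fin_Pow in auto)
  also have "\<dots> = (\<Sum>R | R \<subseteq> F \<and> s \<in> R. \<mu> R)"
    by (rule sum.mono_neutral_left) (use assms fin_Pow in auto)
  finally have "real c = real (h r) + real (h s)" by (simp only: row_tile assms(1,2))
  then show ?thesis by linarith
qed

text \<open>Two disjoint families of rows of total weight \<open>c\<close> exhaust the total; a row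
  outside both would add positive weight.\<close>

lemma row_cover:
  assumes "r \<in> F" "s \<in> F" "h r + h s = c" and "\<And>R. \<mu> R \<noteq> 0 \<Longrightarrow> \<not> (r \<in> R \<and> s \<in> R)"
    and "\<mu> R0 \<noteq> 0"
  shows "r \<in> R0 \<or> s \<in> R0"
proof (rule ccontr)
  assume neg: "\<not> ?thesis"
  have "real (h r) + real (h s) =
      (\<Sum>R | R \<subseteq> F \<and> r \<in> R. \<mu> R) + (\<Sum>R | R \<subseteq> F \<and> s \<in> R. \<mu> R)"
    using row_tile assms by simp
  also have "(\<Sum>R | R \<subseteq> F \<and> s \<in> R. \<mu> R) = (\<Sum>R | R \<subseteq> F \<and> s \<in> R \<and> r \<notin> R. \<mu> R)"
    by (rule sum.mono_neutral_right) (use assms fin_Pow in auto)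
  also have "(\<Sum>R | R \<subseteq> F \<and> r \<in> R. \<mu> R) + \<dots> =
      (\<Sum>R\<in>{R. R \<subseteq> F \<and> r \<in> R} \<union> {R. R \<subseteq> F \<and> s \<in> R \<and> r \<notin> R}. \<mu> R)"
    by (rule sum.union_disjoint[symmetric]) (use fin_Pow in auto)
  also have "\<dots> < (\<Sum>R | R \<subseteq> F. \<mu> R)"
  proof (rule sum_strict_mono2)
    show "R0 \<in> {R. R \<subseteq> F} - ({R. R \<subseteq> F \<and> r \<in> R} \<union> {R. R \<subseteq> F \<and> s \<in> R \<and> r \<notin> R})"
      using neg assms row_subset by auto
    show "0 < \<mu> R0" using row_nonneg[of R0] assms by linarith
  qed (use fin_Pow[of "\<lambda>_. True"] row_nonneg in auto)
  also have "\<dots> = real c" using row_total by (simp add: Pow_def)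
  finally show False using assms(3) by linarith
qed

lemma strip_in_row:
  assumes "r \<in> F" "h r = c" "\<mu> R0 \<noteq> 0" shows "r \<in> R0"
proof (rule ccontr)
  assume neg: "r \<notin> R0"
  have "real (h r) = (\<Sum>R | R \<subseteq> F \<and> r \<in> R. \<mu> R)"
    using row_tile assms by simp
  also have "\<dots> < (\<Sum>R | R \<subseteq> F. \<mu> R)"
  proof (rule sum_strict_mono2)
    show "R0 \<in> {R. R \<subseteq> F} - {R. R \<subseteq> F \<and> r \<in> R}"
      using neg assms row_subset by auto
    show "0 < \<mu> R0" using row_nonneg[of R0] assms by linarith
  qed (use fin_Pow[of "\<lambda>_. True"] row_nonneg in auto)
  also have "\<dots> = real c" using row_total by (simp add: Pow_def)
  finally show False using assms(2) by linarith
qed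

lemma w_le: assumes "r \<in> F" shows "w r \<le> a"
proof -
  obtain R where R: "\<mu> R \<noteq> 0" "r \<in> R" using row_exists[OF assms] by blast
  then show ?thesis using member_le_sum[of r R w] row_sum[OF R(1)] finite_row[OF R(1)] by simp
qed

lemma row_rest:
  assumes "\<mu> R \<noteq> 0" "r \<in> R" shows "sum w (R - {r}) = a - w r"
  using row_sum[OF assms(1)] finite_row[OF assms(1)] assms by (simp add: sum_diff1_nat)

lemma row_singleton:
  assumes "\<mu> R \<noteq> 0" "r \<in> R" "w r = a" shows "R = {r}"
proof -
  have "sum w (R - {r}) = 0"
    by (simp add: row_rest[OF assms(1,2)] assms(3))
  then have "\<forall>s\<in>R - {r}. w s = 0"
    using finite_row[OF assms(1)] by simp
  moreover have "\<forall>s\<in>R. w s \<noteq> 0" using w_pos row_subset[OF assms(1)] by blast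
  ultimately show ?thesis using assms(2) by blast
qed

text \<open>Double counting of the total area: the sum of \<open>w r * \<mu> R\<close> over incident
  pairs is \<open>A\<close> for each tile and \<open>a * \<mu> R\<close> for each row.\<close>

lemma card_times_area: "card F * A = a * c"
proof -
  have "real (card F * A) = (\<Sum>r\<in>F. real (w r) * real (h r))"
  proof -
    have "(\<Sum>r\<in>F. real (w r) * real (h r)) = (\<Sum>r\<in>F. real A)"
      by (rule sum.cong[OF refl]) (metis area of_nat_mult)
    then show ?thesis by simp
  qed
  also have "\<dots> = (\<Sum>r\<in>F. \<Sum>R\<in>Pow F. if r \<in> R then real (w r) * \<mu> R else 0)"
  proof (rule sum.cong[OF refl])
    fix r assume r: "r \<in> F"
    have "real (w r) * real (h r) = real (w r) * (\<Sum>R\<in>{R \<in> Pow F. r \<in> R}. \<mu> R)"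
      using row_tile[OF r] by (simp add: Pow_def)
    also have "\<dots> = (\<Sum>R\<in>{R \<in> Pow F. r \<in> R}. real (w r) * \<mu> R)"
      by (rule sum_distrib_left)
    also have "\<dots> = (\<Sum>R\<in>Pow F. if r \<in> R then real (w r) * \<mu> R else 0)"
      by (rule sum.inter_filter) (use finite_tiles in simp)
    finally show "real (w r) * real (h r) = (\<Sum>R\<in>Pow F. if r \<in> R then real (w r) * \<mu> R else 0)" .
  qed
  also have "\<dots> = (\<Sum>R\<in>Pow F. \<Sum>r\<in>F. if r \<in> R then real (w r) * \<mu> R else 0)"
    by (rule sum.swap)
  also have "\<dots> = (\<Sum>R\<in>Pow F. real a * \<mu> R)"
  proof (rule sum.cong[OF refl])
    fix R assume R: "R \<in> Pow F"
    have "(\<Sum>r\<in>F. if r \<in> R then real (w r) * \<mu> R else 0) = (\<Sum>r\<in>F \<inter> R. real (w r) * \<mu> R)"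
      by (simp add: sum.inter_restrict finite_tiles)
    also have "\<dots> = real (sum w R) * \<mu> R"
      using R by (simp add: sum_distrib_right Int_absorb1)
    also have "\<dots> = real a * \<mu> R" using row_sum[of R] by (cases "\<mu> R = 0") auto
    finally show "(\<Sum>r\<in>F. if r \<in> R then real (w r) * \<mu> R else 0) = real a * \<mu> R" .
  qed
  also have "\<dots> = real (a * c)" by (simp add: row_total flip: sum_distrib_left)
  finally show ?thesis by (simp only: of_nat_eq_iff)
qed

text \<open>A tile of full height lies in every row, and a column through it consists of it alone.
  Deleting it from the rows and dropping its columns preserves the axioms; nothing has to be pushed
  together in the plane.\<close>

lemma remove_strip:
  assumes r: "r \<in> F" "h r = c"
  obtains \<mu>' \<nu>' where "equal_area_tiling (F - {r}) w h A (a - w r) c \<mu>' \<nu>'"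
proof
  interpret D: equal_area_tiling F h w A c a \<nu> \<mu> by (rule dual)
  \<comment> \<open>A row of the smaller tiling inherits the weight of the old row obtained by
    putting \<open>r\<close> back. Sets that still contain \<open>r\<close> are not rows any more
    and get weight 0.\<close>
  let ?m = "\<lambda>R. if r \<in> R then 0 else \<mu> (insert r R)"
  let ?n = "\<lambda>C. if r \<in> C then 0 else \<nu> C"
  have rows: "(\<Sum>R | R \<subseteq> F - {r} \<and> Q R. ?m R) = (\<Sum>R | R \<subseteq> F \<and> Q' R. \<mu> R)"
    if "\<And>R. r \<notin> R \<Longrightarrow> Q' (insert r R) = Q R" for Q Q'
  proof -
    have "(\<Sum>R | R \<subseteq> F - {r} \<and> Q R. ?m R) = (\<Sum>R | R \<subseteq> F \<and> Q' R \<and> r \<in> R. \<mu> R)"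
    proof (rule sum.reindex_bij_witness[where i = "\<lambda>R. R - {r}" and j = "insert r"])
      fix R assume "R \<in> {R. R \<subseteq> F \<and> Q' R \<and> r \<in> R}"
      then show "R - {r} \<in> {R. R \<subseteq> F - {r} \<and> Q R}"
        using that[of "R - {r}"] by (auto simp: insert_absorb)
    qed (use that r in \<open>auto simp: insert_absorb\<close>)
    also have "\<dots> = (\<Sum>R | R \<subseteq> F \<and> Q' R. \<mu> R)"
      by (rule sum.mono_neutral_left) (use strip_in_row[OF r] fin_Pow in auto)
    finally show ?thesis .
  qed
  have cols: "(\<Sum>R | R \<subseteq> F - {r} \<and> Q R. ?n R) = (\<Sum>R | R \<subseteq> F \<and> Q R \<and> r \<notin> R. \<nu> R)" for Q
    by (rule sum.cong) auto
  have split: "(\<Sum>R | R \<subseteq> F. \<nu> R) = (\<Sum>R | R \<subseteq> F \<and> r \<in> R. \<nu> R) + (\<Sum>R | R \<subseteq> F \<and> r \<notin> R. \<nu> R)"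
    by (subst sum.union_disjoint[symmetric]) (use fin_Pow in \<open>auto intro!: sum.cong\<close>)
  show "equal_area_tiling (F - {r}) w h A (a - w r) c ?m ?n"
  proof
    fix R assume m: "?m R \<noteq> 0"
    then have "\<mu> (insert r R) \<noteq> 0" "r \<notin> R" by (auto split: if_splits)
    then show "R \<subseteq> F - {r}" "sum w R = a - w r"
      using row_subset[of "insert r R"] row_sum[of "insert r R"] finite_row[of "insert r R"] by auto
  next
    show "(\<Sum>R\<in>Pow (F - {r}). ?m R) = real c"
      using rows[of "\<lambda>_. True" "\<lambda>_. True"] row_total by (simp add: Pow_def)
    have "(\<Sum>R | R \<subseteq> F - {r}. ?n R) = (\<Sum>R | R \<subseteq> F \<and> r \<notin> R. \<nu> R)"
      using cols[of "\<lambda>_. True"] by simp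
    also have "\<dots> = real a - real (w r)"
      using split col_total col_tile[OF r(1)] by (simp add: Pow_def)
    finally show "(\<Sum>R\<in>Pow (F - {r}). ?n R) = real (a - w r)"
      using w_le[OF r(1)] by (simp add: Pow_def of_nat_diff)
  next
    fix s assume s: "s \<in> F - {r}"
    show "(\<Sum>R | R \<subseteq> F - {r} \<and> s \<in> R. ?m R) = real (h s)"
      using rows[of "\<lambda>R. s \<in> R" "\<lambda>R. s \<in> R"] row_tile[of s] s by auto
    have "(\<Sum>R | R \<subseteq> F - {r} \<and> s \<in> R. ?n R) = (\<Sum>R | R \<subseteq> F \<and> s \<in> R \<and> r \<notin> R. \<nu> R)"
      using cols[of "\<lambda>R. s \<in> R"] by simp
    also have "\<dots> = (\<Sum>R | R \<subseteq> F \<and> s \<in> R. \<nu> R)"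
      by (rule sum.mono_neutral_left) (use D.row_singleton[of _ r] r s fin_Pow in auto)
    finally show "(\<Sum>R | R \<subseteq> F - {r} \<and> s \<in> R. ?n R) = real (w s)"
      using col_tile s by simp
  next
    fix R C s t
    assume "?m R \<noteq> 0" "?n C \<noteq> 0" "s \<in> R" "t \<in> R" "s \<in> C" "t \<in> C"
    then show "s = t" using cross[of "insert r R" C s t] by (auto split: if_splits)
  next
    fix C assume "?n C \<noteq> 0"
    then have "\<nu> C \<noteq> 0" "r \<notin> C" by (auto split: if_splits)
    then show "C \<subseteq> F - {r}" "sum h C = c" using col_subset[of C] col_sum[of C] by auto
  next
    show "0 \<le> ?m R" for R using row_nonneg by simp
    show "0 \<le> ?n R" for R using col_nonneg by simp
    show "finite (F - {r})" using finite_tiles by simp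
    show "w s * h s = A" if "s \<in> F - {r}" for s using area that by simp
    show "s = t" if "s \<in> F - {r}" "t \<in> F - {r}" "w s = w t \<or> w s = h t" for s t
      using incongruent that by blast
    show "0 < A" by (rule area_pos)
  qed
qed

end

section \<open>From partitions to weighted rows and columns\<close>

definition line_tiles :: "'a set \<Rightarrow> ('a \<Rightarrow> real) \<Rightarrow> ('a \<Rightarrow> nat) \<Rightarrow> real \<Rightarrow> 'a set" where
  "line_tiles P b h y = {r \<in> P. b r < y \<and> y < b r + real (h r)}"

text \<open>The Lebesgue measure of the heights at which a horizontal line runs through exactly the
  tiles in \<open>R\<close>. For finitely many tiles the edge heights form a null set, so the open
  intervals in \<open>line_tiles\<close> lose nothing.\<close>

definition line_weight :: "'a set \<Rightarrow> ('a \<Rightarrow> real) \<Rightarrow> ('a \<Rightarrow> nat) \<Rightarrow> nat \<Rightarrow> 'a set \<Rightarrow> real" where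
  "line_weight P b h n R = measure lborel {y \<in> {0..real n}. line_tiles P b h y = R}"

lemma line_tiles_measurable:
  assumes "finite P"
  shows "{y \<in> {0..real n}. line_tiles P b h y = R} \<in> sets lborel"
proof (cases "R \<subseteq> P")
  case True
  define I where "I = (\<lambda>r. if r \<in> R then {b r<..<b r + real (h r)} else - {b r<..<b r + real (h r)})"
  have "I r \<in> sets lborel" for r by (simp add: I_def)
  then have "(\<Inter>r\<in>P. I r) \<in> sets lborel" using assms by (cases "P = {}") auto
  then have "{0..real n} \<inter> (\<Inter>r\<in>P. I r) \<in> sets lborel" by (intro sets.Int) auto
  moreover have "{y \<in> {0..real n}. line_tiles P b h y = R} = {0..real n} \<inter> (\<Inter>r\<in>P. I r)"
  proof (rule set_eqI)
    fix y
    have "line_tiles P b h y = R \<longleftrightarrow> (\<forall>r\<in>P. y \<in> {b r<..<b r + real (h r)} \<longleftrightarrow> r \<in> R)"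
      using True by (auto simp: line_tiles_def)
    moreover have "y \<in> I r \<longleftrightarrow> (y \<in> {b r<..<b r + real (h r)} \<longleftrightarrow> r \<in> R)" for r
      by (simp add: I_def)
    ultimately show "y \<in> {y \<in> {0..real n}. line_tiles P b h y = R} \<longleftrightarrow>
        y \<in> {0..real n} \<inter> (\<Inter>r\<in>P. I r)" by blast
  qed
  ultimately show ?thesis by simp
next
  case False
  then have "{y \<in> {0..real n}. line_tiles P b h y = R} = {}" by (auto simp: line_tiles_def)
  then show ?thesis by (metis sets.empty_sets)
qed

lemma line_emeasure_finite: "emeasure lborel {y \<in> {0..real n}. Q y} \<noteq> \<infinity>"
proof -
  have "emeasure lborel {y \<in> {0..real n}. Q y} \<le> emeasure lborel {0..real n}"
    by (rule emeasure_mono) auto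
  then show ?thesis by (auto simp: top_unique)
qed

lemma sum_line_weight:
  assumes "finite P"
  shows "(\<Sum>R | R \<subseteq> P \<and> Q R. line_weight P b h n R) =
    measure lborel {y \<in> {0..real n}. Q (line_tiles P b h y)}"
proof -
  let ?A = "\<lambda>R. {y \<in> {0..real n}. line_tiles P b h y = R}"
  have "measure lborel (\<Union>R\<in>{R. R \<subseteq> P \<and> Q R}. ?A R) = (\<Sum>R | R \<subseteq> P \<and> Q R. measure lborel (?A R))"
    by (rule measure_finite_Union)
      (use assms line_tiles_measurable line_emeasure_finite in \<open>auto simp: disjoint_family_on_def\<close>)
  moreover have "(\<Union>R\<in>{R. R \<subseteq> P \<and> Q R}. ?A R) = {y \<in> {0..real n}. Q (line_tiles P b h y)}"
    by (auto simp: line_tiles_def)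
  ultimately show ?thesis by (simp add: line_weight_def)
qed

lemma sum_line_weight_total:
  assumes "finite P" shows "(\<Sum>R\<in>Pow P. line_weight P b h n R) = real n"
proof -
  have "{y \<in> {0..real n}. True} = {0..real n}" by auto
  then show ?thesis
    using sum_line_weight[OF assms, where Q = "\<lambda>_. True", of b h n] by (simp add: Pow_def)
qed

lemma sum_line_weight_tile:
  assumes "finite P" "r \<in> P" "0 \<le> b r" "b r + real (h r) \<le> real n"
  shows "(\<Sum>R | R \<subseteq> P \<and> r \<in> R. line_weight P b h n R) = real (h r)"
proof -
  have "{y \<in> {0..real n}. r \<in> line_tiles P b h y} = {b r<..<b r + real (h r)}"
    using assms by (auto simp: line_tiles_def)
  then show ?thesis using sum_line_weight[OF assms(1), where Q = "\<lambda>R. r \<in> R"] by simp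
qed

text \<open>Finite sets have measure zero, so a row of nonzero weight is realised at a height
  avoiding any given finite set, in particular all edges.\<close>

lemma line_weight_generic:
  assumes "line_weight P b h n R \<noteq> 0" "finite B"
  shows "\<exists>y\<in>{0..real n} - B. line_tiles P b h y = R"
proof (rule ccontr)
  assume "\<not> ?thesis"
  then have "{y \<in> {0..real n}. line_tiles P b h y = R} \<subseteq> B" by auto
  then have "finite {y \<in> {0..real n}. line_tiles P b h y = R}" using assms(2) finite_subset by blast
  then have "line_weight P b h n R = 0"
    by (auto simp: line_weight_def measure_def emeasure_lborel_countable countable_finite)
  then show False using assms by simp
qed

text \<open>Lengths are compared from both sides: the closed intervals cover, so their sum is at
  least \<open>n\<close>; the open ones are disjoint and lie inside, so it is at most
  \<open>n\<close>.\<close>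

lemma interval_cover_sum:
  fixes l :: "'a \<Rightarrow> real" and w :: "'a \<Rightarrow> nat"
  assumes "finite Q" and cover: "(\<Union>r\<in>Q. {l r..l r + real (w r)}) = {0..real n}"
    and disj: "\<And>r s. r \<in> Q \<Longrightarrow> s \<in> Q \<Longrightarrow> r \<noteq> s \<Longrightarrow>
      {l r<..<l r + real (w r)} \<inter> {l s<..<l s + real (w s)} = {}"
  shows "sum w Q = n"
proof -
  have "measure lborel (\<Union>r\<in>Q. {l r..l r + real (w r)}) \<le> (\<Sum>r\<in>Q. measure lborel {l r..l r + real (w r)})"
    by (rule measure_UNION_le) (use assms in auto)
  then have "real n \<le> real (sum w Q)" by (simp add: cover)
  moreover have "measure lborel (\<Union>r\<in>Q. {l r<..<l r + real (w r)}) =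
      (\<Sum>r\<in>Q. measure lborel {l r<..<l r + real (w r)})"
    by (rule measure_finite_Union) (use assms in \<open>auto simp: disjoint_family_on_def\<close>)
  moreover have "measure lborel (\<Union>r\<in>Q. {l r<..<l r + real (w r)}) \<le> measure lborel {0..real n}"
  proof (rule measure_mono_fmeasurable)
    show "(\<Union>r\<in>Q. {l r<..<l r + real (w r)}) \<subseteq> {0..real n}"
      unfolding cover[symmetric] by (intro UN_mono) auto
  qed (use assms in \<open>auto simp: fmeasurable_def\<close>)
  ultimately have "real (sum w Q) = real n" by simp
  then show ?thesis by (simp only: of_nat_eq_iff)
qed

lemma line_weight_sum:
  fixes P :: "'a set" and l b :: "'a \<Rightarrow> real" and w h :: "'a \<Rightarrow> nat"
  assumes P: "finite P"
    and cover: "\<And>x y. 0 \<le> x \<and> x \<le> real n \<and> 0 \<le> y \<and> y \<le> real n \<longleftrightarrow>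
      (\<exists>r\<in>P. l r \<le> x \<and> x \<le> l r + real (w r) \<and> b r \<le> y \<and> y \<le> b r + real (h r))"
    and disj: "\<And>r s x y. r \<in> P \<Longrightarrow> s \<in> P \<Longrightarrow>
      l r < x \<Longrightarrow> x < l r + real (w r) \<Longrightarrow> b r < y \<Longrightarrow> y < b r + real (h r) \<Longrightarrow>
      l s < x \<Longrightarrow> x < l s + real (w s) \<Longrightarrow> b s < y \<Longrightarrow> y < b s + real (h s) \<Longrightarrow> r = s"
    and R: "line_weight P b h n R \<noteq> 0"
  shows "sum w R = n"
proof -
  obtain y where y: "y \<in> {0..real n}" "y \<notin> b ` P \<union> (\<lambda>r. b r + real (h r)) ` P"
    and Ry: "line_tiles P b h y = R"
    using line_weight_generic[OF R, of "b ` P \<union> (\<lambda>r. b r + real (h r)) ` P"] P by blast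
  \<comment> \<open>Off the edges, the closed condition of the cover and the open condition of
    disjointness select the same tiles.\<close>
  have strict: "b r \<le> y \<and> y \<le> b r + real (h r) \<longleftrightarrow> b r < y \<and> y < b r + real (h r)"
    if "r \<in> P" for r
  proof -
    have "y \<noteq> b r" "y \<noteq> b r + real (h r)" using y(2) that by auto
    then show ?thesis by linarith
  qed
  have R_def: "R = {r \<in> P. b r < y \<and> y < b r + real (h r)}" using Ry by (simp add: line_tiles_def)
  show ?thesis
  proof (rule interval_cover_sum)
    show "finite R" using P R_def by simp
    show "(\<Union>r\<in>R. {l r..l r + real (w r)}) = {0..real n}"
    proof (rule set_eqI)
      fix x show "x \<in> (\<Union>r\<in>R. {l r..l r + real (w r)}) \<longleftrightarrow> x \<in> {0..real n}"
        using cover[of x y] y(1) strict unfolding R_def by fastforce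
    qed
    show "{l r<..<l r + real (w r)} \<inter> {l s<..<l s + real (w s)} = {}"
      if "r \<in> R" "s \<in> R" "r \<noteq> s" for r s
      using that disj[of r s _ y] unfolding R_def by (auto simp del: Int_greaterThanLessThan)
  qed
qed

lemma perfect_partition_tiling:
  assumes "perfect_mondrian_partition n P"
  obtains A \<mu> \<nu> where "equal_area_tiling P rect_width rect_height A n n \<mu> \<nu>"
proof -
  let ?l = "fst :: rect \<Rightarrow> real" and ?b = "\<lambda>r :: rect. fst (snd r)"
  let ?w = rect_width and ?h = rect_height
  have mp: "mondrian_partition n P" and eq: "\<forall>r\<in>P. \<forall>s\<in>P. rect_area r = rect_area s"
    using assms by (simp add: perfect_mondrian_partition_def, unfold perfect_mondrian_partition_def) blast
  have fin: "finite P" and card: "card P \<ge> 2"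
    and pos: "\<forall>r\<in>P. ?w r > 0 \<and> ?h r > 0"
    and un: "(\<Union>r\<in>P. rect_set r) = {(x, y). 0 \<le> x \<and> x \<le> real n \<and> 0 \<le> y \<and> y \<le> real n}"
    and int: "\<forall>r\<in>P. \<forall>s\<in>P. r \<noteq> s \<longrightarrow> rect_interior r \<inter> rect_interior s = {}"
    and noncong: "\<forall>r\<in>P. \<forall>s\<in>P. r \<noteq> s \<longrightarrow> \<not> congruent_rect r s"
    using mp[unfolded mondrian_partition_def] by - (elim conjE, assumption)+
  have mem: "(x, y) \<in> rect_set r \<longleftrightarrow>
      ?l r \<le> x \<and> x \<le> ?l r + real (?w r) \<and> ?b r \<le> y \<and> y \<le> ?b r + real (?h r)" for x y r
    by (cases r) (simp add: rect_set_def rect_width_def rect_height_def)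
  have memi: "(x, y) \<in> rect_interior r \<longleftrightarrow>
      ?l r < x \<and> x < ?l r + real (?w r) \<and> ?b r < y \<and> y < ?b r + real (?h r)" for x y r
    by (cases r) (simp add: rect_interior_def rect_width_def rect_height_def)
  have cover: "0 \<le> x \<and> x \<le> real n \<and> 0 \<le> y \<and> y \<le> real n \<longleftrightarrow>
      (\<exists>r\<in>P. ?l r \<le> x \<and> x \<le> ?l r + real (?w r) \<and> ?b r \<le> y \<and> y \<le> ?b r + real (?h r))" for x y
  proof -
    have "(x, y) \<in> (\<Union>r\<in>P. rect_set r) \<longleftrightarrow> 0 \<le> x \<and> x \<le> real n \<and> 0 \<le> y \<and> y \<le> real n"
      unfolding un by simp
    moreover have "(x, y) \<in> (\<Union>r\<in>P. rect_set r) \<longleftrightarrow> (\<exists>r\<in>P. (x, y) \<in> rect_set r)" by blast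
    ultimately show ?thesis unfolding mem by blast
  qed
  have disj: "r = s"
    if "r \<in> P" "s \<in> P" "?l r < x" "x < ?l r + real (?w r)" "?b r < y" "y < ?b r + real (?h r)"
      "?l s < x" "x < ?l s + real (?w s)" "?b s < y" "y < ?b s + real (?h s)" for r s x y
    using int memi[of x y r] memi[of x y s] that by blast
  have box: "0 \<le> ?l r \<and> ?l r + real (?w r) \<le> real n \<and> 0 \<le> ?b r \<and> ?b r + real (?h r) \<le> real n"
    if "r \<in> P" for r
  proof -
    have "0 \<le> ?l r \<and> 0 \<le> ?b r" using iffD2[OF cover[of "?l r" "?b r"]] that by fastforce
    moreover have "?l r + real (?w r) \<le> real n \<and> ?b r + real (?h r) \<le> real n"
      using iffD2[OF cover[of "?l r + real (?w r)" "?b r + real (?h r)"]] that by fastforce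
    ultimately show ?thesis by blast
  qed
  obtain r0 where r0: "r0 \<in> P" using card by (cases "P = {}") auto
  define A where "A = rect_area r0"
  have areaA: "?w r * ?h r = A" if "r \<in> P" for r
    using eq[rule_format, OF that r0] by (simp add: A_def rect_area_def)
  have "equal_area_tiling P ?w ?h A n n (line_weight P ?b ?h n) (line_weight P ?l ?w n)"
  proof
    fix r s assume rs: "r \<in> P" "s \<in> P" "?w r = ?w s \<or> ?w r = ?h s"
    then have "?w r * ?h r = ?w s * ?h s" "0 < ?w r" using areaA pos by auto
    then have "congruent_rect r s" using rs(3) by (auto simp: congruent_rect_def mult.commute)
    then show "r = s" using noncong rs by blast
  next
    fix R assume R: "line_weight P ?b ?h n R \<noteq> 0"
    show "sum ?w R = n"
      by (rule line_weight_sum[of P n ?l ?w ?b ?h, OF fin _ _ R]) (rule cover, rule disj, assumption+)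
  next
    fix R assume R: "line_weight P ?l ?w n R \<noteq> 0"
    have cover': "0 \<le> y \<and> y \<le> real n \<and> 0 \<le> x \<and> x \<le> real n \<longleftrightarrow>
        (\<exists>r\<in>P. ?b r \<le> y \<and> y \<le> ?b r + real (?h r) \<and> ?l r \<le> x \<and> x \<le> ?l r + real (?w r))" for x y
      using cover[of x y] by blast
    show "sum ?h R = n"
      by (rule line_weight_sum[of P n ?b ?h ?l ?w, OF fin _ _ R]) (rule cover', rule disj, assumption+)
  next
    fix R C r s
    assume R: "line_weight P ?b ?h n R \<noteq> 0" and C: "line_weight P ?l ?w n C \<noteq> 0"
      and rs: "r \<in> R" "s \<in> R" "r \<in> C" "s \<in> C"
    obtain y where "line_tiles P ?b ?h y = R" using line_weight_generic[OF R, of "{}"] by auto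
    moreover obtain x where "line_tiles P ?l ?w x = C" using line_weight_generic[OF C, of "{}"] by auto
    ultimately show "r = s" using rs disj[of r s x y] by (auto simp: line_tiles_def)
  next
    show "0 < A" using pos r0 by (simp add: A_def rect_area_def)
    show "0 \<le> line_weight P b h n R" for b h R by (simp add: line_weight_def)
    show "0 \<le> line_weight P b h n R" for b h R by (simp add: line_weight_def)
    show "R \<subseteq> P" if "line_weight P ?b ?h n R \<noteq> 0" for R
      using line_weight_generic[OF that, of "{}"] by (auto simp: line_tiles_def)
    show "R \<subseteq> P" if "line_weight P ?l ?w n R \<noteq> 0" for R
      using line_weight_generic[OF that, of "{}"] by (auto simp: line_tiles_def)
    show "(\<Sum>R\<in>Pow P. line_weight P ?b ?h n R) = real n"
      "(\<Sum>R\<in>Pow P. line_weight P ?l ?w n R) = real n"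
      by (rule sum_line_weight_total[OF fin])+
    show "(\<Sum>R | R \<subseteq> P \<and> r \<in> R. line_weight P ?b ?h n R) = real (?h r)"
      "(\<Sum>R | R \<subseteq> P \<and> r \<in> R. line_weight P ?l ?w n R) = real (?w r)" if "r \<in> P" for r
      using sum_line_weight_tile[OF fin that, of ?b ?h n] sum_line_weight_tile[OF fin that, of ?l ?w n]
        box[OF that] by simp_all
  qed (use fin areaA in blast)+
  then show ?thesis by (rule that)
qed

section \<open>At most five tiles\<close>

context equal_area_tiling
begin

text \<open>The strip \<open>r\<close> also lies in each row through the other tile
  \<open>s\<close>, so a column through \<open>s\<close> avoids \<open>r\<close> and is
  \<open>{s}\<close>. Then \<open>s\<close> has height \<open>c\<close> too.\<close>

lemma strip_pair_impossible:
  assumes "card F = 2" "r \<in> F" "h r = c"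
  shows False
proof -
  obtain s where s: "F = {r, s}" "r \<noteq> s" using assms by (auto simp: card_2_iff)
  obtain R where R: "\<mu> R \<noteq> 0" "s \<in> R" using row_exists[of s] s by auto
  obtain C where C: "\<nu> C \<noteq> 0" "s \<in> C" using equal_area_tiling.row_exists[OF dual, of s] s by auto
  have "r \<in> R" using strip_in_row assms R by blast
  then have "C = {s}" using cross[OF R(1) C(1), of r s] C R s col_subset[OF C(1)] by auto
  then have "h s = h r" using col_sum[OF C(1)] assms by simp
  then show False using incongruent_h[of s r] s by auto
qed

text \<open>Each tile of a row \<open>R\<close> has a column that continues outside
  \<open>R\<close>. A single tile outside would give all tiles of \<open>R\<close> equal height, so
  at least two are outside and \<open>R\<close> has exactly two tiles. A row through the taller tile
  of such a pair that avoids the shorter one must then contain a tile as wide as the shorter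
  one.\<close>

lemma no_strip_small_impossible:
  assumes card: "2 \<le> card F" "card F \<le> 4" and strip: "\<And>r. r \<in> F \<Longrightarrow> w r \<noteq> a \<and> h r \<noteq> c"
  shows False
proof -
  have col: "\<exists>C. \<nu> C \<noteq> 0 \<and> r \<in> C \<and> C \<inter> R = {r} \<and> C \<noteq> {r}" if "\<mu> R \<noteq> 0" "r \<in> R" for R r
  proof -
    have "r \<in> F" using that row_subset by blast
    then obtain C where C: "\<nu> C \<noteq> 0" "r \<in> C" using equal_area_tiling.row_exists[OF dual] by blast
    then have "C \<inter> R = {r}" using cross[OF that(1) C(1)] that by blast
    moreover have "C \<noteq> {r}" using col_sum[OF C(1)] strip[OF \<open>r \<in> F\<close>] by auto
    ultimately show ?thesis using C by blast
  qed
  have row: "card R = 2" if R: "\<mu> R \<noteq> 0" "r \<in> R" for R r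
  proof -
    have RF: "R \<subseteq> F" "finite R" using R row_subset finite_row by blast+
    have "R \<noteq> {r}" using row_sum[OF R(1)] strip[of r] RF R by auto
    then obtain s where s: "s \<in> R" "s \<noteq> r" using R by blast
    have "card {r, s} \<le> card R" by (rule card_mono) (use RF R s in auto)
    then have "2 \<le> card R" using s by simp
    have "R \<noteq> F"
    proof
      assume "R = F"
      then show False using col[OF R] col_subset by (metis Int_absorb2)
    qed
    moreover have "card (F - R) \<noteq> 1"
    proof
      assume "card (F - R) = 1"
      then obtain t where t: "F - R = {t}" by (auto simp: card_1_singleton_iff)
      have "h q + h t = c" if q: "q \<in> R" for q
      proof -
        obtain C where C: "\<nu> C \<noteq> 0" "q \<in> C" "C \<inter> R = {q}" "C \<noteq> {q}" using col[OF R(1) q] by blast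
        have "C - R \<subseteq> {t}" unfolding t[symmetric] using col_subset[OF C(1)] by blast
        then have "C \<subseteq> {q, t}" using C(3) by auto
        then have "C = {q, t}" using C(2,4) by auto
        moreover have "q \<noteq> t" using t q by auto
        ultimately show ?thesis using col_sum[OF C(1)] by simp
      qed
      from this[OF R(2)] this[OF s(1)] have "h r = h s" by simp
      then show False using incongruent_h[of r s] s RF R by blast
    qed
    moreover have "card (F - R) = card F - card R" by (rule card_Diff_subset) (use RF in auto)
    moreover have "card R < card F" using RF \<open>R \<noteq> F\<close> finite_tiles by (simp add: psubset_card_mono psubset_eq)
    ultimately show ?thesis using \<open>2 \<le> card R\<close> card by linarith
  qed
  have key: False if R: "\<mu> R \<noteq> 0" "R = {r, s}" "r \<noteq> s" "h r < h s" for R r s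
  proof -
    have F: "r \<in> F" "s \<in> F" using row_subset[OF R(1)] R by auto
    then obtain R' where R': "\<mu> R' \<noteq> 0" "s \<in> R'" "r \<notin> R'"
      using row_contained_le[of s r] R(4) by (meson not_le)
    then obtain t where t: "R' = {s, t}" "t \<noteq> s" using row[OF R'(1,2)] by (auto simp: card_2_iff)
    have "w r + w s = w s + w t" using row_sum[OF R(1)] row_sum[OF R'(1)] R t by simp
    then have "r = t" using incongruent[of r t] F row_subset[OF R'(1)] t by simp
    then show False using R' t by simp
  qed
  obtain r where r: "r \<in> F" using card by (cases "F = {}") auto
  then obtain R where R: "\<mu> R \<noteq> 0" "r \<in> R" using row_exists by blast
  then obtain s where s: "R = {r, s}" "r \<noteq> s" using row[OF R] by (auto simp: card_2_iff)
  have "h r \<noteq> h s" using incongruent_h[of r s] s row_subset[OF R(1)] by auto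
  then show False using key[of R r s] key[of R s r] R s by (metis insert_commute nat_neq_iff)
qed

end

text \<open>Induction on the number of tiles by removing full strips. What remains need not be a
  square, hence the two dimensions \<open>a\<close> and \<open>c\<close> in the locale.\<close>

lemma small_tiling_impossible:
  assumes "equal_area_tiling F w h A a c \<mu> \<nu>" "2 \<le> card F" "card F \<le> 4"
  shows False
  using assms
proof (induction "card F" arbitrary: F w h a c \<mu> \<nu> rule: less_induct)
  case less
  interpret equal_area_tiling F w h A a c \<mu> \<nu> by (rule less.prems)
  have step: False if T: "equal_area_tiling F w' h' A a' c' \<mu>' \<nu>'" "r \<in> F" "h' r = c'"
    for w' h' a' c' \<mu>' \<nu>' r
  proof (cases "card F = 2")
    case True
    then show False using equal_area_tiling.strip_pair_impossible[OF T(1) _ T(2,3)] by simp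
  next
    case False
    obtain \<mu>'' \<nu>'' where "equal_area_tiling (F - {r}) w' h' A (a' - w' r) c' \<mu>'' \<nu>''"
      using equal_area_tiling.remove_strip[OF T] by blast
    moreover have "card (F - {r}) = card F - 1" using T(2) by simp
    moreover have "card (F - {r}) < card F" "2 \<le> card (F - {r})" "card (F - {r}) \<le> 4"
      using calculation(2) less.prems(2,3) False by linarith+
    ultimately show False using less.hyps[of "F - {r}"] by blast
  qed
  show False
    using no_strip_small_impossible[OF less.prems(2,3)] step[OF less.prems(1)] step[OF dual] by blast
qed

section \<open>Five tiles in a square\<close>

context equal_area_tiling
begin

lemma three_in_row_le:
  assumes "\<mu> R \<noteq> 0" "r \<in> R" "s \<in> R" "t \<in> R" "r \<noteq> s" "r \<noteq> t" "s \<noteq> t"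
  shows "w r + w s + w t \<le> a"
proof -
  have "sum w {r, s, t} \<le> sum w R"
    by (rule sum_mono2) (use assms finite_row in auto)
  then show ?thesis using row_sum[OF assms(1)] assms by simp
qed

text \<open>Five tiles without a full strip form a pinwheel around a central tile, and equality of the four
  outer areas forces two neighbouring outer tiles to be congruent.\<close>
lemma pinwheel_impossible:
  assumes sq: "c = a" and card: "card F = 5"
    and strip: "\<And>r. r \<in> F \<Longrightarrow> w r \<noteq> a \<and> h r \<noteq> a"
    and L: "L \<in> F" and max: "\<And>r. r \<in> F \<Longrightarrow> w r \<le> w L \<and> h r \<le> w L"
  shows False
proof -
  interpret D: equal_area_tiling F h w A c a \<nu> \<mu> by (rule dual)
  define x where "x = w L"
  have A5: "5 * A = a * a" using card_times_area card sq by simp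
  \<comment> \<open>The longest side \<open>x\<close> exceeds \<open>h r\<close> strictly, because
    equality would make \<open>r\<close> congruent to \<open>L\<close>.\<close>
  have big: "A < x * w r" if "r \<in> F" "r \<noteq> L" for r
  proof -
    have "h r < x" using max[OF that(1)] incongruent[OF L that(1)] that by (auto simp: x_def le_less)
    then show ?thesis using area[OF that(1)] w_pos[OF that(1)] by (metis mult.commute mult_less_mono1)
  qed
  \<comment> \<open>From \<open>(2x - a)^2 >= 0\<close>: the product \<open>x (a - x)\<close> is at
    most \<open>a^2/4 = 5A/4\<close>, whereas two further tiles in a row with \<open>L\<close> would
    require more than \<open>2A\<close>.\<close>
  have sqr: "4 * (x * a) \<le> 4 * (x * x) + a * a"
  proof -
    have "0 \<le> (2 * int x - int a)\<^sup>2" by simp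
    then have "int (4 * (x * a)) \<le> int (4 * (x * x) + a * a)"
      by (simp add: power2_eq_square algebra_simps)
    then show ?thesis by (simp only: of_nat_le_iff)
  qed
  have nonsingle: "R \<noteq> {r}" if "\<mu> R \<noteq> 0" "r \<in> F" for R r
    using row_sum[OF that(1)] strip[OF that(2)] by auto
  have nonsingle': "C \<noteq> {r}" if "\<nu> C \<noteq> 0" "r \<in> F" for C r
    using col_sum[OF that(1)] strip[OF that(2)] sq by auto
  have pair: "\<exists>s. R = {L, s} \<and> s \<noteq> L" if R: "\<mu> R \<noteq> 0" "L \<in> R" for R
  proof -
    obtain s where s: "s \<in> R" "s \<noteq> L" using nonsingle[OF R(1) L] R(2) by blast
    have "t = s" if t: "t \<in> R" "t \<noteq> L" for t
    proof (rule ccontr)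
      assume "t \<noteq> s"
      then have "x + w s + w t \<le> a" using three_in_row_le[OF R, of s t] s t by (simp add: x_def)
      then have "x * (x + w s + w t) \<le> x * a" by (rule mult_le_mono2)
      moreover have "A < x * w s" "A < x * w t" using big s t row_subset[OF R(1)] by blast+
      ultimately have "x * x + 2 * A < x * a" by (simp add: distrib_left)
      then show False using sqr A5 by simp
    qed
    then show ?thesis using s R by blast
  qed
  obtain R0 where R0: "\<mu> R0 \<noteq> 0" "L \<in> R0" using row_exists[OF L] by blast
  then obtain N where N: "R0 = {L, N}" "N \<noteq> L" using pair by blast
  have NF: "N \<in> F" using row_subset[OF R0(1)] N by simp
  have LN: "w L + w N = a" using row_sum[OF R0(1)] N by simp
  have rowL: "R = {L, N}" if R: "\<mu> R \<noteq> 0" "L \<in> R" for R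
  proof -
    obtain s where s: "R = {L, s}" "s \<noteq> L" using pair[OF R] by blast
    then have "w L + w s = a" using row_sum[OF R(1)] by simp
    then have "w s = w N" using LN by simp
    then have "s = N" using incongruent[of s N] NF row_subset[OF R(1)] s by simp
    then show ?thesis using s by simp
  qed
  have "w N < w L" using max[OF NF] incongruent[OF L NF] N by (metis le_neq_implies_less)
  then have "h L < h N" using area[OF L] area[OF NF] h_pos[OF NF]
    by (metis mult_less_mono1 mult_le_mono2 not_le order_less_le_trans less_irrefl)
  then obtain R1 where R1: "\<mu> R1 \<noteq> 0" "N \<in> R1" "L \<notin> R1"
    using row_contained_le[OF NF L] by (meson not_le)
  have cardNL: "card (F - {L, N}) = 3" using card L NF N by (simp add: card_Diff_subset)
  have rest: "\<exists>p q. p \<noteq> q \<and> R - {N} = {p, q}" if R: "\<mu> R \<noteq> 0" "N \<in> R" "L \<notin> R" for R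
  proof -
    have sub: "R - {N} \<subseteq> F - {L, N}" using row_subset[OF R(1)] R by blast
    have fin: "finite (R - {N})" using finite_row R by blast
    have sumx: "sum w (R - {N}) = x" using row_rest[OF R(1,2)] LN by (simp add: x_def)
    have "R - {N} \<noteq> {}" using nonsingle[OF R(1) NF] R(2) by blast
    then have "card (R - {N}) \<noteq> 0" using fin by (metis card_0_eq)
    moreover have "card (R - {N}) \<noteq> 1"
    proof
      assume "card (R - {N}) = 1"
      then obtain t where t: "R - {N} = {t}" by (auto simp: card_1_singleton_iff)
      then have "w t = w L" using sumx by (simp add: x_def)
      then show False using incongruent[of t L] L t sub by blast
    qed
    \<comment> \<open>Three tiles beside \<open>N\<close> give \<open>3A < x^2\<close>. Squaring
      \<open>x^2 + A < x a\<close> and using \<open>a^2 = 5A\<close> yields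
      \<open>x^4 + A^2 < 3A x^2\<close>, a contradiction.\<close>
    moreover have "card (R - {N}) \<noteq> 3"
    proof
      assume "card (R - {N}) = 3"
      then obtain p q s where t: "R - {N} = {p, q, s}" "p \<noteq> q" "q \<noteq> s" "p \<noteq> s"
        by (auto simp: card_3_iff)
      then have "w p + w q + w s = x" using sumx by simp
      then have "x * w p + x * w q + x * w s = x * x" by (metis distrib_left)
      moreover have "A < x * w p" "A < x * w q" "A < x * w s" using big sub t by blast+
      ultimately have X: "3 * A < x * x" by simp
      have "x * x + x * w N = x * a" using LN by (simp add: x_def flip: distrib_left)
      then have u: "x * x + A < x * a" using big[OF NF N(2)] by simp
      have "(x * x + A) * (x * x + A) < (x * a) * (x * a)" by (rule mult_strict_mono'[OF u u]) auto
      also have "\<dots> = (x * x) * (5 * A)" using A5 by (simp add: algebra_simps)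
      finally have "(x * x) * (x * x) + A * A < 3 * A * (x * x)" by (simp add: algebra_simps)
      moreover have "(3 * A) * (x * x) \<le> (x * x) * (x * x)" using X by (intro mult_le_mono1) simp
      ultimately show False by simp
    qed
    moreover have "card (R - {N}) \<le> 3" using card_mono[OF _ sub] cardNL finite_tiles by simp
    ultimately have "card (R - {N}) = 2" by simp
    then show ?thesis by (auto simp: card_2_iff)
  qed
  obtain p q where pq: "p \<noteq> q" "R1 - {N} = {p, q}" using rest[OF R1] by blast
  have pqF: "p \<in> F - {L, N}" "q \<in> F - {L, N}" using pq row_subset[OF R1(1)] R1 by blast+
  have "card (F - {L, N} - {p, q}) = 1" using cardNL pqF pq by (simp add: card_Diff_subset)
  then obtain k where "F - {L, N} - {p, q} = {k}" by (auto simp: card_1_singleton_iff)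
  then have kF0: "F - {L, N, p, q} = {k}" by auto
  then have kd: "k \<noteq> L" "k \<noteq> N" "k \<noteq> p" "k \<noteq> q" and F: "F = {L, N, p, q, k}"
    using pqF L NF by auto
  have R1eq: "R1 = {N, p, q}" using pq R1 by blast
  have wpq: "w p + w q = w L" using row_rest[OF R1(1,2)] pq LN by simp
  have rowN: "R = {N, p, q}" if R: "\<mu> R \<noteq> 0" "N \<in> R" "L \<notin> R" for R
  proof -
    obtain p' q' where t: "p' \<noteq> q'" "R - {N} = {p', q'}" using rest[OF R] by blast
    have "sum w (R - {N}) = w L" using row_rest[OF R(1,2)] LN by simp
    then have sum: "w p' + w q' = w p + w q" using t wpq by simp
    have sub: "{p', q'} \<subseteq> {p, q, k}" using t F row_subset[OF R(1)] R by blast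
    have "w k \<noteq> w p" "w k \<noteq> w q" using incongruent F kd by blast+
    then have "{p', q'} = {p, q}" using sub sum t(1) by auto
    then show ?thesis using t R by blast
  qed
  have rowk: "R \<subseteq> {p, q, k}" if "\<mu> R \<noteq> 0" "k \<in> R" for R
    using rowL[OF that(1)] rowN[OF that(1)] row_subset[OF that(1)] that(2) kd F by blast
  \<comment> \<open>\<open>N\<close> shares rows with \<open>L\<close>, \<open>p\<close> and
    \<open>q\<close>, so only \<open>k\<close> can complete its column; \<open>k\<close> is the
    outer tile opposite \<open>L\<close>.\<close>
  have colN: "C = {N, k}" if C: "\<nu> C \<noteq> 0" "N \<in> C" for C
  proof -
    have "L \<notin> C" using cross[OF R0(1) C(1), of L N] N C by auto
    moreover have "p \<notin> C" "q \<notin> C" using cross[OF R1(1) C(1), of _ N] R1eq C pqF by blast+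
    ultimately show ?thesis using col_subset[OF C(1)] nonsingle'[OF C(1) NF] C(2) F by blast
  qed
  obtain C0 where C0: "\<nu> C0 \<noteq> 0" "N \<in> C0" using D.row_exists[OF NF] by blast
  have hNk: "h N + h k = a" using col_sum[OF C0(1)] colN[OF C0] kd sq by simp
  have kF: "k \<in> F" using F by simp
  have cover: "N \<in> R \<or> k \<in> R" if "\<mu> R \<noteq> 0" for R
    by (rule row_cover[OF NF kF]) (use hNk sq rowk that kd pqF in auto)
  have rowk2: "R = {k, p} \<or> R = {k, q}" if R: "\<mu> R \<noteq> 0" "k \<in> R" for R
  proof -
    have "R \<noteq> {k, p, q}"
    proof
      assume "R = {k, p, q}"
      then have "w k + (w p + w q) = a" using row_sum[OF R(1)] kd pq by simp
      then have "w k = w N" using wpq LN by simp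
      then show False using incongruent[OF kF NF] kd by blast
    qed
    then show ?thesis using rowk[OF R] R(2) nonsingle[OF R(1) kF] by blast
  qed
  \<comment> \<open>Here \<open>u\<close> is the fourth outer tile, closing the cycle
    \<open>L\<close>, \<open>N\<close>, \<open>k\<close>, \<open>u\<close>; the other one of
    \<open>p\<close>, \<open>q\<close> is the centre. The four side relations express all four outer
    areas through \<open>X\<close>, \<open>Y\<close>, \<open>Z\<close>, \<open>W\<close>.\<close>
  have final: False
    if pq': "w k + w u = a" "\<And>R. \<mu> R \<noteq> 0 \<Longrightarrow> k \<in> R \<Longrightarrow> R = {k, u}" "u \<in> {p, q}" for u
  proof -
    have uF: "u \<in> F" using pq' pqF by blast
    have "h L + h u = c"
    proof (rule row_partition[OF L uF])
      fix R assume R: "\<mu> R \<noteq> 0"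
      show "(L \<in> R) \<noteq> (u \<in> R)"
        using cover[OF R] rowN[OF R] rowL[OF R] pq'(2)[OF R] pq'(3) pqF kd by blast
    qed
    then have Lu: "h L + h u = a" using sq by simp
    define X Y Z W where "X = int (w L)" and "Y = int (h L)" and "Z = int (h k)" and "W = int (w k)"
    have "int (w N) = int a - X" "int (h N) = int a - Z" "int (w u) = int a - W" "int (h u) = int a - Y"
      using LN hNk pq'(1) Lu unfolding X_def Y_def Z_def W_def by linarith+
    moreover have "int (w r) * int (h r) = int A" if "r \<in> F" for r
      using area[OF that] by (simp flip: of_nat_mult)
    ultimately have e1: "X * Y = int A" and e2: "(int a - X) * (int a - Z) = int A"
      and e3: "W * Z = int A" and e4: "(int a - W) * (int a - Y) = int A"
      using L NF kF uF unfolding X_def Y_def Z_def W_def by metis+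
    have a2: "int a * int a = 5 * int A" using A5 by (metis of_nat_mult of_nat_numeral)
    have f1: "int a * (X + Z) = 4 * int A + X * Z" using e2 a2 by (simp add: algebra_simps)
    have f2: "int a * (W + Y) = 4 * int A + W * Y" using e4 a2 by (simp add: algebra_simps)
    \<comment> \<open>Eliminating \<open>X + Z\<close> and \<open>W + Y\<close> by means of
      \<open>f1\<close>, \<open>f2\<close>, and \<open>X Z W Y = A^2\<close>, leaves
      \<open>3A X Z = 3A^2\<close>. Then \<open>f1\<close> gives \<open>X + Z = a\<close>, so
      \<open>w L = h N\<close>.\<close>
    have "(X * Z) * (int a * (W + Y)) = int a * (X * (W * Z) + Z * (X * Y))"
      by (simp add: algebra_simps)
    also have "\<dots> = int A * (int a * (X + Z))" unfolding e1 e3 by (simp add: algebra_simps)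
    finally have "(X * Z) * (int a * (W + Y)) = int A * (int a * (X + Z))" .
    then have "(X * Z) * (4 * int A + W * Y) = int A * (4 * int A + X * Z)" using f1 f2 by simp
    moreover have "(X * Z) * (W * Y) = (X * Y) * (W * Z)" by (simp add: algebra_simps)
    then have "(X * Z) * (W * Y) = int A * int A" unfolding e1 e3 .
    ultimately have "(3 * int A) * (X * Z) = (3 * int A) * int A" by (simp add: algebra_simps)
    then have "X * Z = int A" using area_pos by simp
    then have "int a * (X + Z) = int a * int a" using f1 a2 by simp
    then have "X + Z = int a" using area_pos A5 by auto
    then have "w L = h N" using hNk unfolding X_def Z_def by linarith
    then show False using incongruent[OF L NF] N by blast
  qed
  obtain Rk where Rk: "\<mu> Rk \<noteq> 0" "k \<in> Rk" using row_exists[OF kF] by blast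
  have "w p \<noteq> w q" using incongruent pqF pq by blast
  from rowk2[OF Rk] show False
  proof
    assume "Rk = {k, p}"
    then have e: "w k + w p = a" using row_sum[OF Rk(1)] kd by simp
    have "R \<noteq> {k, q}" if "\<mu> R \<noteq> 0" for R
      using row_sum[OF that] e \<open>w p \<noteq> w q\<close> kd by auto
    then show False using final[OF e] rowk2 by blast
  next
    assume "Rk = {k, q}"
    then have e: "w k + w q = a" using row_sum[OF Rk(1)] kd by simp
    have "R \<noteq> {k, p}" if "\<mu> R \<noteq> 0" for R
      using row_sum[OF that] e \<open>w p \<noteq> w q\<close> kd by auto
    then show False using final[OF e] rowk2 by blast
  qed
qed

end

lemma five_square_tiling_impossible:
  assumes "equal_area_tiling F w h A a a \<mu> \<nu>" "card F = 5"
  shows False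
proof -
  interpret equal_area_tiling F w h A a a \<mu> \<nu> by (rule assms(1))
  have strip: False if T: "equal_area_tiling F w' h' A a a \<mu>' \<nu>'" "r \<in> F" "h' r = a" for w' h' \<mu>' \<nu>' r
  proof -
    obtain \<mu>'' \<nu>'' where "equal_area_tiling (F - {r}) w' h' A (a - w' r) a \<mu>'' \<nu>''"
      using equal_area_tiling.remove_strip[OF T] by blast
    moreover have "card (F - {r}) = 4" using T(2) assms(2) by simp
    ultimately show False using small_tiling_impossible by fastforce
  qed
  have ns: "w r \<noteq> a \<and> h r \<noteq> a" if "r \<in> F" for r
    using strip[OF assms(1) that] strip[OF dual that] by blast
  define m where "m = Max (w ` F \<union> h ` F)"
  have fin: "finite (w ` F \<union> h ` F)" using finite_tiles by simp
  have ne: "F \<noteq> {}" using assms(2) by auto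
  have le: "w r \<le> m \<and> h r \<le> m" if "r \<in> F" for r
    using that fin unfolding m_def by (auto intro!: Max_ge)
  have "m \<in> w ` F \<union> h ` F" unfolding m_def by (rule Max_in) (use fin ne in auto)
  then obtain L where "L \<in> F" "m = w L \<or> m = h L" by auto
  then show False
    using pinwheel_impossible[OF refl assms(2) ns, of L]
      equal_area_tiling.pinwheel_impossible[OF dual refl assms(2), of L] ns le by blast
qed

section \<open>Explicit squares\<close>

fun subset_sums :: "nat list \<Rightarrow> nat \<Rightarrow> nat list list" where
  "subset_sums [] l = (if l = 0 then [[]] else [])"
| "subset_sums (v # vs) l =
    subset_sums vs l @ (if v \<le> l then map ((#) v) (subset_sums vs (l - v)) else [])"

lemma subset_sums_complete:
  assumes "V \<subseteq> set vs" "\<Sum>V = l"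
  shows "\<exists>xs\<in>set (subset_sums vs l). V = set xs"
  using assms
proof (induction vs arbitrary: V l)
  case Nil
  then show ?case by simp
next
  case (Cons v vs)
  have fin: "finite V" using Cons.prems(1) finite_subset by blast
  show ?case
  proof (cases "v \<in> V")
    case True
    then have l: "l = v + \<Sum>(V - {v})" using Cons.prems(2) fin by (simp add: sum.remove)
    have "V - {v} \<subseteq> set vs" using Cons.prems(1) by auto
    then obtain xs where "xs \<in> set (subset_sums vs (l - v))" "V - {v} = set xs"
      using Cons.IH[of "V - {v}" "l - v"] l by auto
    then show ?thesis using True l by (intro bexI[of _ "v # xs"]) auto
  next
    case False
    then have "V \<subseteq> set vs" using Cons.prems(1) by auto
    then show ?thesis using Cons.IH[of V l] Cons.prems(2) by auto
  qed
qed

text \<open>A shape with side \<open>e\<close> in either direction is dropped, because the tile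
  whose row is being completed already uses that side.\<close>

definition other_widths :: "nat \<Rightarrow> (nat \<times> nat) list \<Rightarrow> nat list" where
  "other_widths e D = map fst (filter (\<lambda>(x, y). x \<noteq> e \<and> y \<noteq> e) D)"

text \<open>The shorter side stands for a shape up to rotation, which loses nothing among pairs with
  a common product.\<close>

definition kinds :: "(nat \<times> nat) list \<Rightarrow> nat list" where
  "kinds D = remdups (map (\<lambda>(x, y). min x y) D)"

section \<open>Completing rows and columns from a finite list of shapes\<close>

context equal_area_tiling
begin

lemma row_completion:
  assumes D: "\<forall>s\<in>F. (w s, h s) \<in> set D" and R: "\<mu> R \<noteq> 0" "r \<in> R"
  shows "\<exists>xs\<in>set (subset_sums (other_widths (w r) D) (a - w r)). w ` (R - {r}) = set xs"
proof -
  have RF: "R \<subseteq> F" using row_subset R by blast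
  have "w ` (R - {r}) \<subseteq> set (other_widths (w r) D)"
  proof
    fix v assume "v \<in> w ` (R - {r})"
    then obtain s where s: "s \<in> F" "s \<in> R" "s \<noteq> r" "v = w s" using RF by blast
    then have "w s \<noteq> w r" "h s \<noteq> w r" using incongruent[of r s] incongruent[of s r] R RF by force+
    then show "v \<in> set (other_widths (w r) D)" using D s(1,4) by (force simp: other_widths_def)
  qed
  moreover have "\<Sum>(w ` (R - {r})) = a - w r"
  proof -
    have "inj_on w (R - {r})" using incongruent RF by (meson DiffD1 inj_onI subsetD)
    then have "\<Sum>(w ` (R - {r})) = sum w (R - {r})" by (simp add: sum.reindex)
    then show ?thesis using row_rest[OF R] by simp
  qed
  ultimately show ?thesis by (rule subset_sums_complete)
qed

text \<open>Pigeonhole on the shorter side. When there are as many tiles as shapes, every shape must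
  occur, and a shape with a side that cannot be completed gives a contradiction.\<close>

lemma card_le_kinds:
  assumes D: "\<forall>s\<in>F. (w s, h s) \<in> set D"
  shows "card F \<le> length (kinds D)"
    and "length (kinds D) \<le> card F \<Longrightarrow> d \<in> set (kinds D) \<Longrightarrow> \<exists>r\<in>F. min (w r) (h r) = d"
proof -
  let ?m = "\<lambda>r. min (w r) (h r)"
  have inj: "inj_on ?m F" by (rule inj_on_side) (simp add: min_def)
  have sub: "?m ` F \<subseteq> set (kinds D)" using D by (force simp: kinds_def)
  have len: "card (set (kinds D)) = length (kinds D)" unfolding kinds_def by (rule distinct_card) simp
  have card: "card (?m ` F) = card F" using inj by (rule card_image)
  show "card F \<le> length (kinds D)" using card_mono[OF _ sub] card len by simp
  assume "length (kinds D) \<le> card F" "d \<in> set (kinds D)"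
  then have "?m ` F = set (kinds D)" using card_seteq[OF _ sub] card len by simp
  then have "d \<in> ?m ` F" using \<open>d \<in> set (kinds D)\<close> by simp
  then show "\<exists>r\<in>F. min (w r) (h r) = d" by blast
qed

end

text \<open>Area and weights are hidden, since the explicit arguments only need a finite list of
  admissible oriented shapes, which shrinks as orientations are ruled out.\<close>

definition listed_tiling ::
  "'a set \<Rightarrow> ('a \<Rightarrow> nat) \<Rightarrow> ('a \<Rightarrow> nat) \<Rightarrow> nat \<Rightarrow> nat \<Rightarrow> (nat \<times> nat) list \<Rightarrow> bool" where
  "listed_tiling F w h a c D \<longleftrightarrow> (\<exists>A \<mu> \<nu>. equal_area_tiling F w h A a c \<mu> \<nu>) \<and>
    (\<forall>r\<in>F. (w r, h r) \<in> set D)"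

lemma listed_tilingE:
  assumes "listed_tiling F w h a c D"
  obtains A \<mu> \<nu> where "equal_area_tiling F w h A a c \<mu> \<nu>"
  using assms by (auto simp: listed_tiling_def)

lemma listed_in: "listed_tiling F w h a c D \<Longrightarrow> r \<in> F \<Longrightarrow> (w r, h r) \<in> set D"
  by (simp add: listed_tiling_def)

lemma listed_all: "listed_tiling F w h a c D \<Longrightarrow> \<forall>r\<in>F. (w r, h r) \<in> set D"
  by (simp add: listed_tiling_def)

lemma listed_dual:
  assumes "listed_tiling F w h a c D" shows "listed_tiling F h w c a (map prod.swap D)"
  using assms equal_area_tiling.dual unfolding listed_tiling_def by fastforce

lemma listed_strip:
  assumes T: "listed_tiling F w h a c D" and r: "r \<in> F" "h r = c"
  shows "listed_tiling (F - {r}) w h (a - w r) c (filter (\<lambda>(x, y). x \<noteq> w r \<and> y \<noteq> w r) D)"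
proof -
  obtain A \<mu> \<nu> where E: "equal_area_tiling F w h A a c \<mu> \<nu>" by (rule listed_tilingE[OF T])
  then have "\<exists>\<mu>' \<nu>'. equal_area_tiling (F - {r}) w h A (a - w r) c \<mu>' \<nu>'"
    using equal_area_tiling.remove_strip[OF E r] by blast
  moreover have "w s \<noteq> w r" "h s \<noteq> w r" if "s \<in> F - {r}" for s
    using equal_area_tiling.incongruent[OF E, of r s] equal_area_tiling.incongruent_h[OF E, of s r] that r
    by auto
  ultimately show ?thesis using listed_in[OF T] unfolding listed_tiling_def by fastforce
qed

lemma listed_strip_w:
  assumes T: "listed_tiling F w h a c D" and r: "r \<in> F" "w r = a"
  shows "listed_tiling (F - {r}) w h a (c - h r) (filter (\<lambda>(x, y). x \<noteq> h r \<and> y \<noteq> h r) D)"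
proof -
  have "listed_tiling (F - {r}) h w (c - h r) a
      (filter (\<lambda>(x, y). x \<noteq> h r \<and> y \<noteq> h r) (map prod.swap D))"
    by (rule listed_strip[OF listed_dual[OF T] r])
  from listed_dual[OF this] show ?thesis
    by (rule back_subst[of "listed_tiling (F - {r}) w h a (c - h r)"]) (induction D; auto)
qed

lemma listed_mono:
  assumes "listed_tiling F w h a c D" and "\<And>r. r \<in> F \<Longrightarrow> (w r, h r) \<in> set D \<Longrightarrow> (w r, h r) \<in> set D'"
  shows "listed_tiling F w h a c D'"
  using assms by (auto simp: listed_tiling_def)

lemma listed_completion:
  assumes T: "listed_tiling F w h a c D" and r: "r \<in> F"
  shows "\<exists>xs\<in>set (subset_sums (other_widths (w r) D) (a - w r)). \<forall>v\<in>set xs. \<exists>s\<in>F - {r}. w s = v"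
proof -
  obtain A \<mu> \<nu> where "equal_area_tiling F w h A a c \<mu> \<nu>" by (rule listed_tilingE[OF T])
  then interpret equal_area_tiling F w h A a c \<mu> \<nu> .
  obtain R where R: "\<mu> R \<noteq> 0" "r \<in> R" using row_exists[OF r] by blast
  obtain xs where xs: "xs \<in> set (subset_sums (other_widths (w r) D) (a - w r))" "w ` (R - {r}) = set xs"
    using row_completion[OF listed_all[OF T] R] by blast
  have "\<exists>s\<in>F - {r}. w s = v" if "v \<in> set xs" for v
    using that row_subset[OF R(1)] unfolding xs(2)[symmetric] by blast
  then show ?thesis using xs(1) by blast
qed

lemma listed_no_w:
  assumes "listed_tiling F w h a c D" "r \<in> F" "subset_sums (other_widths (w r) D) (a - w r) = []"
  shows False
  using listed_completion[OF assms(1,2)] assms(3) by simp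

lemma listed_no_h:
  assumes "listed_tiling F w h a c D" "r \<in> F"
    "subset_sums (other_widths (h r) (map prod.swap D)) (c - h r) = []"
  shows False
  using listed_no_w[OF listed_dual[OF assms(1)] assms(2,3)] .

lemma listed_single:
  assumes T: "listed_tiling F w h a c D" and r: "r \<in> F"
    and s: "subset_sums (other_widths (w r) D) (a - w r) = [[v]]"
  obtains s where "s \<in> F" "s \<noteq> r" "w s = v"
  using listed_completion[OF T r] s by auto

lemma listed_card: "listed_tiling F w h a c D \<Longrightarrow> card F \<le> length (kinds D)"
  using equal_area_tiling.card_le_kinds(1) unfolding listed_tiling_def by metis

lemma listed_kind:
  assumes T: "listed_tiling F w h a c D" and "length (kinds D) \<le> card F" "d \<in> set (kinds D)"
  obtains r where "r \<in> F" "min (w r) (h r) = d"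
proof -
  obtain A \<mu> \<nu> where E: "equal_area_tiling F w h A a c \<mu> \<nu>" by (rule listed_tilingE[OF T])
  show ?thesis using equal_area_tiling.card_le_kinds(2)[OF E listed_all[OF T]] assms(2,3) that by blast
qed

lemma listed_finite: "listed_tiling F w h a c D \<Longrightarrow> finite F"
  using equal_area_tiling.finite_tiles unfolding listed_tiling_def by metis

definition oriented :: "(nat \<times> nat) list \<Rightarrow> (nat \<times> nat) list" where
  "oriented K = K @ map prod.swap K"

lemma listed_oriented_dual:
  "listed_tiling F w h a c (oriented K) \<Longrightarrow> listed_tiling F h w c a (oriented K)"
  using listed_dual[of F w h a c "oriented K"] by (auto simp: listed_tiling_def oriented_def)

text \<open>The shape \<open>d\<close> by \<open>e\<close> is forced to occur, but in neither
  orientation can the line along its longer side be completed to \<open>n\<close>.\<close>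

lemma no_side_square:
  assumes T: "listed_tiling F w h n n (oriented K)" "length (kinds (oriented K)) \<le> card F"
    and e: "(d, e) \<in> set K" "d \<le> e" "\<And>y. (d, y) \<in> set (oriented K) \<Longrightarrow> y = e"
    and none: "subset_sums (other_widths e (oriented K)) (n - e) = []"
  shows False
proof -
  have "d \<in> set (kinds (oriented K))" using e(1,2) by (force simp: kinds_def oriented_def min_def)
  then obtain r where r: "r \<in> F" "min (w r) (h r) = d" using listed_kind[OF T] by blast
  have "(h r, w r) \<in> set (oriented K)" using listed_in[OF listed_oriented_dual[OF T(1)] r(1)] .
  then have "w r = e \<or> h r = e"
    using listed_in[OF T(1) r(1)] e(3) r(2) by (auto simp: min_def split: if_splits)
  then show False
    using listed_no_w[OF T(1) r(1)] listed_no_w[OF listed_oriented_dual[OF T(1)] r(1)] none by auto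
qed

lemmas evaluate = oriented_def other_widths_def kinds_def

text \<open>The lists in the following lemmas are the factor pairs of the tile area that survive the counting
  arguments in the prime factors of \<open>n\<close>.\<close>

lemma no_tiling_210_by_6:
  assumes "listed_tiling F w h 210 210
      (oriented [(35, 210), (42, 175), (49, 150), (50, 147), (70, 105), (75, 98)])" "card F = 6"
  shows False
  by (rule no_side_square[OF assms(1), of 49 150]) (use assms(2) in \<open>auto simp: evaluate\<close>)

lemma no_tiling_714_by_7:
  assumes "listed_tiling F w h 714 714
      (oriented [(102, 714), (119, 612), (126, 578), (153, 476), (204, 357), (238, 306), (252, 289)])"
    "card F = 7"
  shows False
  by (rule no_side_square[OF assms(1), of 126 578]) (use assms(2) in \<open>auto simp: evaluate\<close>)

lemma no_tiling_770_by_7: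
  assumes "listed_tiling F w h 770 770
      (oriented [(110, 770), (140, 605), (154, 550), (175, 484), (220, 385), (242, 350), (275, 308)])"
    "card F = 7"
  shows False
  by (rule no_side_square[OF assms(1), of 140 605]) (use assms(2) in \<open>auto simp: evaluate\<close>)

lemma no_tiling_910_by_7:
  assumes "listed_tiling F w h 910 910
      (oriented [(130, 910), (169, 700), (175, 676), (182, 650), (260, 455), (325, 364), (338, 350)])"
    "card F = 7"
  shows False
  by (rule no_side_square[OF assms(1), of 169 700]) (use assms(2) in \<open>auto simp: evaluate\<close>)

text \<open>Next to the full strip, the tile \<open>r\<close> spans the square, so both can be removed.\<close>
lemma strip_and_spanning_tile:
  assumes T: "listed_tiling F w h n n (oriented K)" and r: "r \<in> F" "w r < n"
    and only: "subset_sums (other_widths (w r) (oriented K)) (n - w r) = [[d]]"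
    and d: "\<And>y. (d, y) \<in> set (oriented K) \<Longrightarrow> y = n"
  obtains G where "listed_tiling G w h (w r) (n - h r)
      (filter (\<lambda>(x, y). x \<noteq> h r \<and> y \<noteq> h r \<and> x \<noteq> n - w r \<and> y \<noteq> n - w r) (oriented K))"
    "card F = card G + 2" "G \<subseteq> F" "\<And>q. q \<in> F \<Longrightarrow> h q \<noteq> h r \<Longrightarrow> w q \<noteq> n - w r \<Longrightarrow> q \<in> G"
proof -
  obtain s where s: "s \<in> F" "s \<noteq> r" "w s = d" using listed_single[OF T r(1) only] .
  then have hs: "h s = n" using listed_in[OF T s(1)] d by simp
  \<comment> \<open>Here soundness of the enumeration is used: a listed completion has the required
    sum, so \<open>d\<close> is the gap \<open>n - w r\<close>.\<close>
  have "[d] \<in> set (subset_sums vs (n - w r)) \<Longrightarrow> d = n - w r" for vs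
  proof -
    have "sum_list xs = l" if "xs \<in> set (subset_sums vs l)" for xs vs l
      using that by (induction vs l arbitrary: xs rule: subset_sums.induct) (auto split: if_splits)
    then show "[d] \<in> set (subset_sums vs (n - w r)) \<Longrightarrow> d = n - w r" by fastforce
  qed
  then have dn: "d = n - w r" using only by (metis list.set_intros(1))
  have T1: "listed_tiling (F - {s}) w h (n - d) n (filter (\<lambda>(x, y). x \<noteq> d \<and> y \<noteq> d) (oriented K))"
    using listed_strip[OF T s(1) hs] s(3) by simp
  have nd: "n - d = w r" using dn r(2) by simp
  have rs: "r \<in> F - {s}" using r s by simp
  have T2: "listed_tiling (F - {s} - {r}) w h (n - d) (n - h r)
      (filter (\<lambda>(x, y). x \<noteq> h r \<and> y \<noteq> h r) (filter (\<lambda>(x, y). x \<noteq> d \<and> y \<noteq> d) (oriented K)))"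
    by (rule listed_strip_w[OF T1 rs]) (simp add: nd)
  have fin: "finite F" by (rule listed_finite[OF T])
  show ?thesis
  proof
    show "listed_tiling (F - {s} - {r}) w h (w r) (n - h r)
      (filter (\<lambda>(x, y). x \<noteq> h r \<and> y \<noteq> h r \<and> x \<noteq> n - w r \<and> y \<noteq> n - w r) (oriented K))"
      by (rule listed_mono[OF T2[unfolded nd]]) (auto simp: dn)
    have "card {s, r} \<le> card F" by (rule card_mono) (use s r fin in auto)
    then show "card F = card (F - {s} - {r}) + 2" using s r fin by (simp add: card_Diff_singleton_if)
    show "q \<in> F - {s} - {r}" if "q \<in> F" "h q \<noteq> h r" "w q \<noteq> n - w r" for q
      using that s dn by auto
  qed auto
qed

text \<open>Seven shapes for seven tiles force \<open>91\<close> by \<open>468\<close>, whose gap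
  \<open>78\<close> needs the full strip. In the remaining \<open>468\<close> by \<open>455\<close>
  rectangle five shapes for five tiles force \<open>117\<close> by \<open>364\<close>, but its gaps
  \<open>104\<close> and \<open>91\<close> cannot be filled.\<close>

lemma no_tiling_546_by_7:
  assumes T: "listed_tiling F w h 546 546
      (oriented [(78, 546), (91, 468), (117, 364), (126, 338), (156, 273), (169, 252), (182, 234)])"
      (is "listed_tiling _ _ _ _ _ (oriented ?K)")
    and card: "card F = 7"
  shows False
proof -
  have key: False if T: "listed_tiling F w h 546 546 (oriented ?K)" and r: "r \<in> F" "w r = 468"
    for w h :: "'a \<Rightarrow> nat" and r
  proof -
    have hr: "h r = 91" using listed_in[OF T r(1)] r(2) by (simp add: oriented_def)
    obtain G where G: "listed_tiling G w h (w r) (546 - h r)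
        (filter (\<lambda>(x, y). x \<noteq> h r \<and> y \<noteq> h r \<and> x \<noteq> 546 - w r \<and> y \<noteq> 546 - w r) (oriented ?K))"
      "card F = card G + 2"
      by (rule strip_and_spanning_tile[OF T r(1), of 78]) (use r hr in \<open>auto simp: evaluate\<close>)
    note G1 = G(1)[unfolded r hr]
    have G2: "listed_tiling G w h 468 455
        (oriented [(117, 364), (126, 338), (156, 273), (169, 252), (182, 234)])"
      using G1 by (simp add: oriented_def)
    obtain q where q: "q \<in> G" "min (w q) (h q) = 117"
      by (rule listed_kind[OF G2, of 117]) (use G(2) card in \<open>simp_all add: evaluate\<close>)
    then have "w q = 364 \<or> h q = 364" using listed_in[OF G2 q(1)] by (auto simp: oriented_def)
    then show False
      using listed_no_w[OF G2 q(1)] listed_no_h[OF G2 q(1)] by (auto simp: evaluate)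
  qed
  obtain r where r: "r \<in> F" "min (w r) (h r) = 91"
    by (rule listed_kind[OF T, of 91]) (use card in \<open>simp_all add: evaluate\<close>)
  then have "w r = 468 \<or> h r = 468" using listed_in[OF T r(1)] by (auto simp: oriented_def)
  then show False using key[OF T r(1)] key[OF listed_oriented_dual[OF T] r(1)] by blast
qed

text \<open>Eight shapes for seven tiles leave one to spare, so excluding both \<open>77\<close> by
  \<open>396\<close> and the full strip suffices.\<close>

lemma no_tiling_462_by_7:
  assumes T: "listed_tiling F w h 462 462 (oriented [(66, 462), (77, 396), (84, 363), (99, 308),
      (121, 252), (126, 242), (132, 231), (154, 198)])"
      (is "listed_tiling _ _ _ _ _ (oriented ?K)")
    and card: "card F = 7"
  shows False
proof -
  have no396: "w r \<noteq> 396" if T: "listed_tiling F w h 462 462 (oriented ?K)" and r: "r \<in> F"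
    for w h :: "'a \<Rightarrow> nat" and r
  proof
    assume wr: "w r = 396"
    have hr: "h r = 77" using listed_in[OF T r] wr by (simp add: oriented_def)
    obtain G where G: "listed_tiling G w h (w r) (462 - h r)
        (filter (\<lambda>(x, y). x \<noteq> h r \<and> y \<noteq> h r \<and> x \<noteq> 462 - w r \<and> y \<noteq> 462 - w r) (oriented ?K))"
      "card F = card G + 2"
      by (rule strip_and_spanning_tile[OF T r, of 66]) (use wr hr in \<open>auto simp: evaluate\<close>)
    have G2: "listed_tiling G w h 396 385
        (oriented [(84, 363), (99, 308), (121, 252), (126, 242), (132, 231), (154, 198)])"
      using G(1)[unfolded wr hr] by (simp add: oriented_def)
    \<comment> \<open>The sides \<open>363\<close> and \<open>308\<close> leave gaps
      \<open>33\<close>, \<open>22\<close>, \<open>88\<close>, \<open>77\<close>, none of which can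
      be filled; four shapes remain for five tiles.\<close>
    have "listed_tiling G w h 396 385 (oriented [(121, 252), (126, 242), (132, 231), (154, 198)])"
    proof (rule listed_mono[OF G2])
      fix q assume q: "q \<in> G"
      have "w q \<noteq> 363" "w q \<noteq> 308" using listed_no_w[OF G2 q] by (auto simp: evaluate)
      moreover have "h q \<noteq> 363" "h q \<noteq> 308" using listed_no_h[OF G2 q] by (auto simp: evaluate)
      ultimately show "(w q, h q) \<in> set (oriented [(121, 252), (126, 242), (132, 231), (154, 198)])"
        using listed_in[OF G2 q] by (auto simp: oriented_def)
    qed
    then show False using listed_card G(2) card by (fastforce simp: evaluate)
  qed
  have strip: "h r \<noteq> 462" if T: "listed_tiling F w h 462 462 (oriented ?K)" and r: "r \<in> F"
    for w h :: "'a \<Rightarrow> nat" and r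
  proof
    assume hr: "h r = 462"
    have wr: "w r = 66" using listed_in[OF T r] hr by (simp add: oriented_def)
    have "listed_tiling (F - {r}) w h 396 462 (filter (\<lambda>(x, y). x \<noteq> 66 \<and> y \<noteq> 66) (oriented ?K))"
      using listed_strip[OF T r hr] wr by simp
    then have G: "listed_tiling (F - {r}) w h 396 462
        (oriented [(84, 363), (99, 308), (121, 252), (126, 242), (132, 231), (154, 198)])"
    proof (rule listed_mono)
      fix q assume "q \<in> F - {r}"
      then have "w q \<noteq> 396" "h q \<noteq> 396"
        using no396[OF T, of q] no396[OF listed_oriented_dual[OF T], of q] by auto
      then show "(w q, h q) \<in> set (filter (\<lambda>(x, y). x \<noteq> 66 \<and> y \<noteq> 66) (oriented ?K)) \<Longrightarrow>
        (w q, h q) \<in> set (oriented [(84, 363), (99, 308), (121, 252), (126, 242), (132, 231), (154, 198)])"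
        by (auto simp: oriented_def)
    qed
    \<comment> \<open>Six shapes for six tiles. The \<open>84\<close> by \<open>363\<close> tile
      must stand upright and needs \<open>99\<close> below or above it, hence the tile
      \<open>308\<close> wide and \<open>99\<close> high, whose row lacks \<open>88\<close>.\<close>
    obtain q where q: "q \<in> F - {r}" "min (w q) (h q) = 84"
      by (rule listed_kind[OF G, of 84]) (use card r in \<open>simp_all add: evaluate\<close>)
    have "w q \<noteq> 363" using listed_no_w[OF G q(1)] by (auto simp: evaluate)
    then have hq: "h q = 363" using q listed_in[OF G q(1)] by (auto simp: oriented_def)
    obtain s where s: "s \<in> F - {r}" "h s = 99"
      by (rule listed_single[OF listed_dual[OF G] q(1), of 99]) (use hq in \<open>simp_all add: evaluate\<close>)
    then have "w s = 308" using listed_in[OF G s(1)] by (auto simp: oriented_def)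
    then show False using listed_no_w[OF G s(1)] by (auto simp: evaluate)
  qed
  have "listed_tiling F w h 462 462
      (oriented [(84, 363), (99, 308), (121, 252), (126, 242), (132, 231), (154, 198)])"
  proof (rule listed_mono[OF T])
    fix q assume q: "q \<in> F"
    have "w q \<noteq> 396" "h q \<noteq> 396" "w q \<noteq> 462" "h q \<noteq> 462"
      using no396[OF T q] no396[OF listed_oriented_dual[OF T] q]
        strip[OF T q] strip[OF listed_oriented_dual[OF T] q] by auto
    then show "(w q, h q) \<in> set (oriented ?K) \<Longrightarrow>
      (w q, h q) \<in> set (oriented [(84, 363), (99, 308), (121, 252), (126, 242), (132, 231), (154, 198)])"
      by (auto simp: oriented_def)
  qed
  then show False using listed_card card by (fastforce simp: evaluate)
qed

text \<open>Ten shapes for seven tiles. The sides \<open>175\<close> and \<open>180\<close> and the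
  full strip are excluded in turn; the seven shapes left must then all occur, and \<open>42\<close>
  by \<open>150\<close> fails because of \<open>cross\<close>.\<close>

lemma no_tiling_210_by_7:
  assumes T: "listed_tiling F w h 210 210 (oriented [(30, 210), (35, 180), (36, 175), (42, 150),
      (45, 140), (50, 126), (60, 105), (63, 100), (70, 90), (75, 84)])"
      (is "listed_tiling _ _ _ _ _ (oriented ?K)")
    and card: "card F = 7"
  shows False
proof -
  have no175: "w r \<noteq> 175" if T: "listed_tiling F w h 210 210 (oriented ?K)" and r: "r \<in> F"
    for w h :: "'a \<Rightarrow> nat" and r
  proof
    assume wr: "w r = 175"
    \<comment> \<open>The gap \<open>35\<close> is filled by an upright \<open>35\<close> by
      \<open>180\<close> tile, whose column needs the full strip of height \<open>30\<close>.
      Without these two, \<open>r\<close> spans the remaining width \<open>175\<close>, and removing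
      it as well leaves a rectangle with four tiles.\<close>
    obtain s where s: "s \<in> F" "s \<noteq> r" "w s = 35"
      by (rule listed_single[OF T r, of 35]) (use wr in \<open>simp_all add: evaluate\<close>)
    have hs: "h s = 180" using listed_in[OF T s(1)] s(3) by (simp add: oriented_def)
    obtain G where G: "listed_tiling G h w (h s) (210 - w s)
        (filter (\<lambda>(x, y). x \<noteq> w s \<and> y \<noteq> w s \<and> x \<noteq> 210 - h s \<and> y \<noteq> 210 - h s) (oriented ?K))"
      "card F = card G + 2" "\<And>q. q \<in> F \<Longrightarrow> w q \<noteq> w s \<Longrightarrow> h q \<noteq> 210 - h s \<Longrightarrow> q \<in> G"
      by (rule strip_and_spanning_tile[OF listed_oriented_dual[OF T] s(1), of 30])
        (use s hs in \<open>auto simp: evaluate\<close>)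
    have hr: "h r = 36" using listed_in[OF T r] wr by (simp add: oriented_def)
    have "r \<in> G" using G(3)[OF r] wr hr s hs by simp
    then have "listed_tiling (G - {r}) h w (h s - h r) 175
        (filter (\<lambda>(x, y). x \<noteq> h r \<and> y \<noteq> h r)
        (filter (\<lambda>(x, y). x \<noteq> w s \<and> y \<noteq> w s \<and> x \<noteq> 210 - h s \<and> y \<noteq> 210 - h s) (oriented ?K)))"
      by (intro listed_strip) (use G(1) wr s in simp_all)
    then obtain A \<mu> \<nu> where "equal_area_tiling (G - {r}) h w A (h s - h r) 175 \<mu> \<nu>"
      by (rule listed_tilingE)
    moreover have "card (G - {r}) = 4" using G(2) card \<open>r \<in> G\<close> by simp
    ultimately show False using small_tiling_impossible by fastforce
  qed
  let ?K9 = "[(30, 210), (35, 180), (42, 150), (45, 140), (50, 126), (60, 105), (63, 100), (70, 90), (75, 84)]"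
  let ?K7 = "[(42, 150), (45, 140), (50, 126), (60, 105), (63, 100), (70, 90), (75, 84)] :: (nat \<times> nat) list"
  have T9: "listed_tiling F w h 210 210 (oriented ?K9)"
  proof (rule listed_mono[OF T])
    fix q assume q: "q \<in> F"
    have "w q \<noteq> 175" "h q \<noteq> 175"
      using no175[OF T q] no175[OF listed_oriented_dual[OF T] q] by auto
    then show "(w q, h q) \<in> set (oriented ?K) \<Longrightarrow> (w q, h q) \<in> set (oriented ?K9)"
      by (auto simp: oriented_def)
  qed
  have no180: "w r \<noteq> 180" if T: "listed_tiling F w h 210 210 (oriented ?K9)" and r: "r \<in> F"
    for w h :: "'a \<Rightarrow> nat" and r
  proof
    assume wr: "w r = 180"
    have hr: "h r = 35" using listed_in[OF T r] wr by (simp add: oriented_def)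
    obtain G where G: "listed_tiling G w h (w r) (210 - h r)
        (filter (\<lambda>(x, y). x \<noteq> h r \<and> y \<noteq> h r \<and> x \<noteq> 210 - w r \<and> y \<noteq> 210 - w r) (oriented ?K9))"
      "card F = card G + 2"
      by (rule strip_and_spanning_tile[OF T r, of 30]) (use wr hr in \<open>auto simp: evaluate\<close>)
    have G2: "listed_tiling G w h 180 175 (oriented ?K7)"
      using G(1)[unfolded wr hr] by (simp add: oriented_def)
    have G3: "listed_tiling G w h 180 175 (oriented [(50, 126), (60, 105), (63, 100), (70, 90), (75, 84)])"
    proof (rule listed_mono[OF G2])
      fix q assume q: "q \<in> G"
      have "w q \<noteq> 150" "w q \<noteq> 140" using listed_no_w[OF G2 q] by (auto simp: evaluate)
      moreover have "h q \<noteq> 150" "h q \<noteq> 140" using listed_no_h[OF G2 q] by (auto simp: evaluate)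
      ultimately show "(w q, h q) \<in> set (oriented [(50, 126), (60, 105), (63, 100), (70, 90), (75, 84)])"
        using listed_in[OF G2 q] by (auto simp: oriented_def)
    qed
    \<comment> \<open>Five shapes for five tiles, but the side \<open>126\<close> leaves gaps
      \<open>54\<close> and \<open>49\<close>.\<close>
    obtain q where q: "q \<in> G" "min (w q) (h q) = 50"
      by (rule listed_kind[OF G3, of 50]) (use G(2) card in \<open>simp_all add: evaluate\<close>)
    then have "w q = 126 \<or> h q = 126" using listed_in[OF G3 q(1)] by (auto simp: oriented_def)
    then show False
      using listed_no_w[OF G3 q(1)] listed_no_h[OF G3 q(1)] by (auto simp: evaluate)
  qed
  let ?K8 = "(30, 210) # ?K7"
  have T8: "listed_tiling F w h 210 210 (oriented ?K8)"
  proof (rule listed_mono[OF T9])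
    fix q assume q: "q \<in> F"
    have "w q \<noteq> 180" "h q \<noteq> 180"
      using no180[OF T9 q] no180[OF listed_oriented_dual[OF T9] q] by auto
    then show "(w q, h q) \<in> set (oriented ?K9) \<Longrightarrow> (w q, h q) \<in> set (oriented ?K8)"
      by (auto simp: oriented_def)
  qed
  have strip: "h r \<noteq> 210" if T: "listed_tiling F w h 210 210 (oriented ?K8)" and r: "r \<in> F"
    for w h :: "'a \<Rightarrow> nat" and r
  proof
    assume hr: "h r = 210"
    have wr: "w r = 30" using listed_in[OF T r] hr by (simp add: oriented_def)
    have G: "listed_tiling (F - {r}) w h 180 210 (oriented ?K7)"
      using listed_strip[OF T r hr] wr by (simp add: oriented_def)
    \<comment> \<open>Six tiles fill a \<open>180\<close> by \<open>210\<close> rectangle;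
      orientations are discarded until only five shapes are left.\<close>
    have G2: "listed_tiling (F - {r}) w h 180 210 [(42, 150), (45, 140), (50, 126), (60, 105), (63, 100),
        (70, 90), (75, 84), (105, 60), (100, 63), (90, 70), (84, 75)]"
    proof (rule listed_mono[OF G])
      fix q assume q: "q \<in> F - {r}"
      have "w q \<noteq> 150" "w q \<noteq> 140" "w q \<noteq> 126" using listed_no_w[OF G q] by (auto simp: evaluate)
      then show "(w q, h q) \<in> set (oriented ?K7) \<Longrightarrow> (w q, h q) \<in> set [(42, 150), (45, 140), (50, 126),
          (60, 105), (63, 100), (70, 90), (75, 84), (105, 60), (100, 63), (90, 70), (84, 75)]"
        by (auto simp: oriented_def)
    qed
    have G3: "listed_tiling (F - {r}) w h 180 210 [(42, 150), (45, 140), (50, 126), (63, 100),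
        (70, 90), (75, 84), (105, 60), (90, 70), (84, 75)]"
    proof (rule listed_mono[OF G2])
      fix q assume q: "q \<in> F - {r}"
      have "h q \<noteq> 105" using listed_no_h[OF G2 q] by (auto simp: evaluate)
      moreover have "w q \<noteq> 100" using listed_no_w[OF G2 q] by (auto simp: evaluate)
      ultimately show "(w q, h q) \<in> set [(42, 150), (45, 140), (50, 126), (63, 100),
          (70, 90), (75, 84), (105, 60), (90, 70), (84, 75)]"
        using listed_in[OF G2 q] by auto
    qed
    have "listed_tiling (F - {r}) w h 180 210 [(42, 150), (45, 140), (50, 126),
        (75, 84), (105, 60), (84, 75)]"
    proof (rule listed_mono[OF G3])
      fix q assume q: "q \<in> F - {r}"
      have "h q \<noteq> 100" "h q \<noteq> 90" using listed_no_h[OF G3 q] by (auto simp: evaluate)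
      moreover have "w q \<noteq> 90" using listed_no_w[OF G3 q] by (auto simp: evaluate)
      ultimately show "(w q, h q) \<in> set [(42, 150), (45, 140), (50, 126), (75, 84), (105, 60), (84, 75)]"
        using listed_in[OF G3 q] by auto
    qed
    from listed_card[OF this] show False using card r by (simp add: evaluate)
  qed
  have T7: "listed_tiling F w h 210 210 (oriented ?K7)"
  proof (rule listed_mono[OF T8])
    fix q assume q: "q \<in> F"
    have "w q \<noteq> 210" "h q \<noteq> 210"
      using strip[OF T8 q] strip[OF listed_oriented_dual[OF T8] q] by auto
    then show "(w q, h q) \<in> set (oriented ?K8) \<Longrightarrow> (w q, h q) \<in> set (oriented ?K7)"
      by (auto simp: oriented_def)
  qed
  have no150: "w r \<noteq> 150" if T: "listed_tiling F w h 210 210 (oriented ?K7)" and r: "r \<in> F"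
    for w h :: "'a \<Rightarrow> nat" and r
  proof
    assume wr: "w r = 150"
    then have hr: "h r = 42" using listed_in[OF T r] by (simp add: oriented_def)
    obtain A \<mu> \<nu> where E: "equal_area_tiling F w h A 210 210 \<mu> \<nu>" by (rule listed_tilingE[OF T])
    then interpret equal_area_tiling F w h A 210 210 \<mu> \<nu> .
    interpret D: equal_area_tiling F h w A 210 210 \<nu> \<mu> by (rule dual)
    obtain R where R: "\<mu> R \<noteq> 0" "r \<in> R" using row_exists[OF r] by blast
    \<comment> \<open>Only \<open>60\<close> completes \<open>150\<close>, and the \<open>60\<close>
      by \<open>105\<close> tile needs \<open>42 + 63\<close> in its column. The tile of height
      \<open>42\<close> is \<open>r\<close>, which would share a row and a column with
      \<open>s\<close>.\<close>
    have "60 \<in> w ` (R - {r})"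
      using row_completion[OF listed_all[OF T] R] wr by (simp add: evaluate)
    then obtain s where "60 = w s" "s \<in> R - {r}" by (rule imageE)
    then have s: "s \<in> R" "s \<noteq> r" "w s = 60" by auto
    have sF: "s \<in> F" using row_subset[OF R(1)] s by blast
    have hs: "h s = 105" using listed_in[OF T sF] s by (simp add: oriented_def)
    obtain C where C: "\<nu> C \<noteq> 0" "s \<in> C" using D.row_exists[OF sF] by blast
    have "42 \<in> h ` (C - {s})"
      using D.row_completion[OF listed_all[OF listed_oriented_dual[OF T]] C] hs by (simp add: evaluate)
    then have "\<exists>t\<in>C. h t = 42" by force
    then obtain t where t: "t \<in> C" "h t = 42" by blast
    then have "t = r" using incongruent_h[of t r] hr r col_subset[OF C(1)] by auto
    then show False using cross[OF R(1) C(1), of r s] R C s t by simp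
  qed
  obtain r where r: "r \<in> F" "min (w r) (h r) = 42"
    by (rule listed_kind[OF T7, of 42]) (use card in \<open>simp_all add: evaluate\<close>)
  then have "w r = 150 \<or> h r = 150" using listed_in[OF T7 r(1)] by (auto simp: oriented_def)
  then show False using no150[OF T7 r(1)] no150[OF listed_oriented_dual[OF T7] r(1)] by blast
qed

text \<open>Twelve shapes for eleven tiles; excluding the side \<open>300\<close> and then the full
  strip leaves ten.\<close>

lemma no_tiling_330_by_11:
  assumes T: "listed_tiling F w h 330 330 (oriented [(30, 330), (33, 300), (36, 275), (44, 225),
      (45, 220), (50, 198), (55, 180), (60, 165), (66, 150), (75, 132), (90, 110), (99, 100)])"
      (is "listed_tiling _ _ _ _ _ (oriented ?K)")
    and card: "card F = 11"
  shows False
proof -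
  have no300: "w r \<noteq> 300" if T: "listed_tiling F w h 330 330 (oriented ?K)" and r: "r \<in> F"
    for w h :: "'a \<Rightarrow> nat" and r
  proof
    assume wr: "w r = 300"
    have hr: "h r = 33" using listed_in[OF T r] wr by (simp add: oriented_def)
    obtain G where G: "listed_tiling G w h (w r) (330 - h r)
        (filter (\<lambda>(x, y). x \<noteq> h r \<and> y \<noteq> h r \<and> x \<noteq> 330 - w r \<and> y \<noteq> 330 - w r) (oriented ?K))"
      "card F = card G + 2"
      by (rule strip_and_spanning_tile[OF T r, of 30]) (use wr hr in \<open>auto simp: evaluate\<close>)
    let ?K9 = "[(44, 225), (45, 220), (50, 198), (55, 180), (60, 165), (66, 150), (75, 132), (90, 110), (99, 100)]"
    let ?K8 = "[(44, 225), (50, 198), (55, 180), (60, 165), (66, 150), (75, 132), (90, 110), (99, 100)]"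
    have G2: "listed_tiling G w h 300 297 (oriented ((36, 275) # ?K9))"
      using G(1)[unfolded wr hr] by (simp add: oriented_def)
    \<comment> \<open>The shape \<open>36\<close> by \<open>275\<close> has to go before
      \<open>45\<close> by \<open>220\<close>: the gap \<open>80\<close> beside \<open>220\<close>
      would otherwise be filled by \<open>36 + 44\<close>.\<close>
    have G3: "listed_tiling G w h 300 297 (oriented ?K9)"
    proof (rule listed_mono[OF G2])
      fix q assume q: "q \<in> G"
      have "w q \<noteq> 275" using listed_no_w[OF G2 q] by (auto simp: evaluate)
      moreover have "h q \<noteq> 275" using listed_no_h[OF G2 q] by (auto simp: evaluate)
      ultimately show "(w q, h q) \<in> set (oriented ?K9)"
        using listed_in[OF G2 q] by (auto simp: oriented_def)
    qed
    have "listed_tiling G w h 300 297 (oriented ?K8)"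
    proof (rule listed_mono[OF G3])
      fix q assume q: "q \<in> G"
      have "w q \<noteq> 220" using listed_no_w[OF G3 q] by (auto simp: evaluate)
      moreover have "h q \<noteq> 220" using listed_no_h[OF G3 q] by (auto simp: evaluate)
      ultimately show "(w q, h q) \<in> set (oriented ?K8)"
        using listed_in[OF G3 q] by (auto simp: oriented_def)
    qed
    from listed_card[OF this] show False using G(2) card by (simp add: evaluate)
  qed
  let ?K10 = "[(36, 275), (44, 225), (45, 220), (50, 198), (55, 180), (60, 165), (66, 150), (75, 132),
    (90, 110), (99, 100)] :: (nat \<times> nat) list"
  let ?K11 = "(30, 330) # ?K10"
  have T11: "listed_tiling F w h 330 330 (oriented ?K11)"
  proof (rule listed_mono[OF T])
    fix q assume q: "q \<in> F"
    have "w q \<noteq> 300" "h q \<noteq> 300"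
      using no300[OF T q] no300[OF listed_oriented_dual[OF T] q] by auto
    then show "(w q, h q) \<in> set (oriented ?K) \<Longrightarrow> (w q, h q) \<in> set (oriented ?K11)"
      by (auto simp: oriented_def)
  qed
  have strip: "h r \<noteq> 330" if T: "listed_tiling F w h 330 330 (oriented ?K11)" and r: "r \<in> F"
    for w h :: "'a \<Rightarrow> nat" and r
  proof
    assume hr: "h r = 330"
    have wr: "w r = 30" using listed_in[OF T r] hr by (simp add: oriented_def)
    have G: "listed_tiling (F - {r}) w h 300 330 (oriented ?K10)"
      using listed_strip[OF T r hr] wr by (simp add: oriented_def)
    have card10: "card (F - {r}) = 10" using card r by simp
    \<comment> \<open>Ten shapes for ten tiles. The forced upright tile of height \<open>275\<close>
      has gap \<open>55\<close>, giving \<open>u\<close> of width \<open>180\<close>; the gap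
      \<open>120\<close> in the row of \<open>u\<close> gives the \<open>75\<close> by
      \<open>132\<close> tile \<open>p\<close>.\<close>
    obtain t where t: "t \<in> F - {r}" "min (w t) (h t) = 36"
      by (rule listed_kind[OF G, of 36]) (use card10 in \<open>simp_all add: evaluate\<close>)
    have "w t \<noteq> 275" using listed_no_w[OF G t(1)] by (auto simp: evaluate)
    then have ht: "w t = 36" "h t = 275" using listed_in[OF G t(1)] t(2) by (auto simp: oriented_def)
    obtain A \<mu> \<nu> where "equal_area_tiling (F - {r}) w h A 300 330 \<mu> \<nu>" by (rule listed_tilingE[OF G])
    then interpret equal_area_tiling "F - {r}" w h A 300 330 \<mu> \<nu> .
    interpret D: equal_area_tiling "F - {r}" h w A 330 300 \<nu> \<mu> by (rule dual)
    note row = row_completion[OF listed_all[OF G]]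
    note col = D.row_completion[OF listed_all[OF listed_oriented_dual[OF G]]]
    obtain C where C: "\<nu> C \<noteq> 0" "t \<in> C" using D.row_exists[OF t(1)] by blast
    have "55 \<in> h ` (C - {t})" using col[OF C] ht by (simp add: evaluate)
    then obtain u where "55 = h u" "u \<in> C - {t}" by (rule imageE)
    then have u: "u \<in> C" "u \<noteq> t" "h u = 55" by auto
    have uF: "u \<in> F - {r}" using col_subset[OF C(1)] u by blast
    have wu: "w u = 180" using listed_in[OF G uF] u by (simp add: oriented_def)
    obtain R where R: "\<mu> R \<noteq> 0" "u \<in> R" using row_exists[OF uF] by blast
    have "75 \<in> w ` (R - {u})" using row[OF R] wu by (auto simp: evaluate)
    then obtain p where "75 = w p" "p \<in> R - {u}" by (rule imageE)
    then have p: "p \<in> R" "p \<noteq> u" "w p = 75" by auto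
    have pF: "p \<in> F - {r}" using row_subset[OF R(1)] p by blast
    have hp: "h p = 132" using listed_in[OF G pF] p by (simp add: oriented_def)
    \<comment> \<open>\<open>u\<close> shares a row with \<open>p\<close>, so it is in no column
      through \<open>p\<close>, and the gap \<open>198\<close> must be filled by the tile of that
      height. This tile is \<open>50\<close> wide, yet it would be met by all columns through
      \<open>p\<close>, which is \<open>75\<close> wide.\<close>
    have "\<exists>z\<in>C'. h z = 198" if C': "\<nu> C' \<noteq> 0" "p \<in> C'" for C'
    proof -
      have "55 \<notin> h ` (C' - {p})"
      proof
        assume "55 \<in> h ` (C' - {p})"
        then have "\<exists>v\<in>C'. h v = 55" by force
        then obtain v where v: "v \<in> C'" "h v = 55" by blast
        then have "v = u" using incongruent_h[of v u] u uF col_subset[OF C'(1)] by auto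
        then show False using cross[OF R(1) C'(1), of u p] R C' p v by simp
      qed
      then have "198 \<in> h ` (C' - {p})" using col[OF C'] hp by (auto simp: evaluate)
      then show ?thesis by force
    qed
    note z = this
    obtain C1 where C1: "\<nu> C1 \<noteq> 0" "p \<in> C1" using D.row_exists[OF pF] by blast
    then obtain z0 where z0: "z0 \<in> C1" "h z0 = 198" using z by blast
    have zF: "z0 \<in> F - {r}" using col_subset[OF C1(1)] z0 by blast
    have "z0 \<in> C'" if C': "\<nu> C' \<noteq> 0" "p \<in> C'" for C'
    proof -
      obtain y where y: "y \<in> C'" "h y = 198" using z[OF C'] by blast
      then have "y = z0" using incongruent_h[of y z0] z0 zF col_subset[OF C'(1)] by auto
      then show ?thesis using y by simp
    qed
    then have "w p \<le> w z0" using D.row_contained_le[OF pF zF] by blast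
    moreover have "w z0 = 50" using listed_in[OF G zF] z0 by (simp add: oriented_def)
    ultimately show False using p by simp
  qed
  have "listed_tiling F w h 330 330 (oriented ?K10)"
  proof (rule listed_mono[OF T11])
    fix q assume q: "q \<in> F"
    have "w q \<noteq> 330" "h q \<noteq> 330"
      using strip[OF T11 q] strip[OF listed_oriented_dual[OF T11] q] by auto
    then show "(w q, h q) \<in> set (oriented ?K11) \<Longrightarrow> (w q, h q) \<in> set (oriented ?K10)"
      by (auto simp: oriented_def)
  qed
  from listed_card[OF this] show False using card by (simp add: evaluate)
qed

section \<open>Divisors of squares of squarefree numbers\<close>

lemma squarefree_square_divisor:
  fixes S :: "nat set"
  assumes "finite S" "\<And>p. p \<in> S \<Longrightarrow> prime p" "k dvd (\<Prod>S)\<^sup>2"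
  shows "\<exists>T U. T \<subseteq> S \<and> U \<subseteq> S \<and> T \<inter> U = {} \<and> k = \<Prod>T * (\<Prod>U)\<^sup>2"
  using assms
proof (induction S arbitrary: k rule: finite_induct)
  case empty
  then show ?case by simp
next
  case (insert p S)
  have "k dvd p\<^sup>2 * (\<Prod>S)\<^sup>2" using insert by (simp add: power_mult_distrib)
  then obtain k1 k2 where k: "k = k1 * k2" "k1 dvd p\<^sup>2" "k2 dvd (\<Prod>S)\<^sup>2"
    using division_decomp by blast
  obtain T U where TU: "T \<subseteq> S" "U \<subseteq> S" "T \<inter> U = {}" "k2 = \<Prod>T * (\<Prod>U)\<^sup>2"
    using insert.IH[of k2] insert.prems k(3) by blast
  have fin: "finite T" "finite U" "p \<notin> T" "p \<notin> U" using TU insert.hyps finite_subset by blast+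
  obtain i where "i \<le> 2" "k1 = p ^ i"
    using k(2) insert.prems(1) divides_primepow_nat by blast
  then consider "k1 = 1" | "k1 = p" | "k1 = p\<^sup>2" by (auto simp: le_Suc_eq numeral_2_eq_2)
  then show ?case
  proof cases
    case 1
    then show ?thesis using TU k by auto
  next
    case 2
    then have "k = \<Prod>(insert p T) * (\<Prod>U)\<^sup>2" using TU k fin by simp
    then show ?thesis using TU fin by (intro exI[of _ "insert p T"] exI[of _ U]) auto
  next
    case 3
    then have "k = \<Prod>T * (\<Prod>(insert p U))\<^sup>2" using TU k fin by (simp add: power_mult_distrib)
    then show ?thesis using TU fin by (intro exI[of _ T] exI[of _ "insert p U"]) auto
  qed
qed

text \<open>The largest of \<open>m\<close> distinct integers above 1 is at least
  \<open>m + 1\<close>; induction on the rest.\<close>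

lemma prod_ge_fact:
  fixes S :: "nat set"
  assumes "finite S" "\<And>p. p \<in> S \<Longrightarrow> 2 \<le> p"
  shows "fact (card S + 1) \<le> \<Prod>S"
  using assms
proof (induction "card S" arbitrary: S)
  case 0
  then show ?case by simp
next
  case (Suc m)
  then have ne: "S \<noteq> {}" by auto
  define x where "x = Max S"
  have x: "x \<in> S" unfolding x_def using Suc.prems ne by simp
  have "S \<subseteq> {2..x}" using Suc.prems unfolding x_def by auto
  then have "card S \<le> card {2..x}" by (intro card_mono) auto
  then have "card S + 1 \<le> x" using Suc.prems(2)[OF x] by simp
  moreover have "fact (card (S - {x}) + 1) \<le> \<Prod>(S - {x})"
    by (rule Suc.hyps(1)) (use Suc x in auto)
  moreover have "card (S - {x}) + 1 = card S" using x Suc.hyps(2) by simp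
  ultimately have "(card S + 1) * fact (card S) \<le> x * \<Prod>(S - {x})"
    by (intro mult_le_mono) (simp_all only:)
  then show ?case using x Suc.prems(1) by (simp add: prod.remove)
qed

lemma card_divisors_mult_le:
  fixes a b :: nat
  assumes "a > 0" "b > 0"
  shows "card {d. d dvd a * b} \<le> card {d. d dvd a} * card {d. d dvd b}"
proof -
  have fin: "finite {d. d dvd a}" "finite {d. d dvd b}" using assms by auto
  have "{d. d dvd a * b} \<subseteq> (\<lambda>(x, y). x * y) ` ({d. d dvd a} \<times> {d. d dvd b})"
  proof
    fix d assume "d \<in> {d. d dvd a * b}"
    then obtain x y where "d = x * y" "x dvd a" "y dvd b" using division_decomp[of d a b] by blast
    then show "d \<in> (\<lambda>(x, y). x * y) ` ({d. d dvd a} \<times> {d. d dvd b})" by force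
  qed
  then have "card {d. d dvd a * b} \<le> card ({d. d dvd a} \<times> {d. d dvd b})"
    by (rule surj_card_le[rotated]) (use fin in simp)
  then show ?thesis by (simp add: card_cartesian_product)
qed

lemma card_divisors_primepow_le:
  assumes "prime (p :: nat)" shows "card {d. d dvd p ^ e} \<le> e + 1"
proof -
  have "{d. d dvd p ^ e} = (\<lambda>i. p ^ i) ` {..e}"
    using divides_primepow_nat[OF assms, of _ e] by auto
  then show ?thesis using card_image_le[of "{..e}" "\<lambda>i. p ^ i"] by simp
qed

lemma card_divisors_prod_le:
  fixes S :: "nat set"
  assumes "finite S" "\<And>p. p \<in> S \<Longrightarrow> prime p"
  shows "card {d. d dvd (\<Prod>S) ^ e} \<le> (e + 1) ^ card S"
  using assms
proof (induction S rule: finite_induct)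
  case empty
  then show ?case by simp
next
  case (insert p S)
  have pos: "\<Prod>S > 0" "p > 0" using insert.prems by (auto intro!: prod_pos simp: prime_gt_0_nat)
  have "card {d. d dvd (\<Prod>(insert p S)) ^ e} = card {d. d dvd p ^ e * (\<Prod>S) ^ e}"
    using insert.hyps by (simp add: power_mult_distrib)
  also have "\<dots> \<le> card {d. d dvd p ^ e} * card {d. d dvd (\<Prod>S) ^ e}"
    by (rule card_divisors_mult_le) (use pos in auto)
  also have "\<dots> \<le> (e + 1) * (e + 1) ^ card S"
    by (intro mult_le_mono card_divisors_primepow_le insert.IH) (use insert.prems in auto)
  finally show ?case using insert.hyps by simp
qed

text \<open>The involution \<open>d\<close> to \<open>M^2 / d\<close> exchanges the divisors above
  and below \<open>M\<close>, and the two halves share only \<open>M\<close>.\<close>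

lemma card_upper_divisors:
  fixes M :: nat
  assumes "M > 0"
  shows "2 * card {d. d dvd M\<^sup>2 \<and> M \<le> d} \<le> card {d. d dvd M\<^sup>2} + 1"
proof -
  let ?U = "{d. d dvd M\<^sup>2 \<and> M \<le> d}" and ?L = "{d. d dvd M\<^sup>2 \<and> d \<le> M}"
  have fin: "finite {d. d dvd M\<^sup>2}" using assms by simp
  have "card ?U \<le> card ?L"
  proof (rule card_inj_on_le[where f = "\<lambda>d. M\<^sup>2 div d"])
    show "inj_on (\<lambda>d. M\<^sup>2 div d) ?U"
    proof (rule inj_onI)
      fix x y assume xy: "x \<in> ?U" "y \<in> ?U" "M\<^sup>2 div x = M\<^sup>2 div y"
      then have e: "x * (M\<^sup>2 div x) = M\<^sup>2" "y * (M\<^sup>2 div x) = M\<^sup>2"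
        using dvd_mult_div_cancel[of x "M\<^sup>2"] dvd_mult_div_cancel[of y "M\<^sup>2"] by simp_all
      then have "M\<^sup>2 div x \<noteq> 0" using assms by (metis mult_0_right power_not_zero less_numeral_extra(3))
      moreover have "x * (M\<^sup>2 div x) = y * (M\<^sup>2 div x)" using e by simp
      ultimately show "x = y" by simp
    qed
    show "(\<lambda>d. M\<^sup>2 div d) ` ?U \<subseteq> ?L"
    proof (rule image_subsetI)
      fix d assume d: "d \<in> ?U"
      then have e: "d * (M\<^sup>2 div d) = M * M" by (simp add: power2_eq_square)
      have "M\<^sup>2 div d \<le> M"
      proof (rule ccontr)
        assume "\<not> M\<^sup>2 div d \<le> M"
        then have "M * M < d * (M\<^sup>2 div d)" using d assms by (intro mult_le_less_imp_less) auto
        then show False using e by simp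
      qed
      moreover have "M\<^sup>2 div d dvd M\<^sup>2" using dvd_triv_right[of "M\<^sup>2 div d" d] unfolding e
        by (simp add: power2_eq_square)
      ultimately show "M\<^sup>2 div d \<in> ?L" by simp
    qed
    show "finite ?L" using fin by simp
  qed
  moreover have "card ?U + card ?L = card (?U \<union> ?L) + card (?U \<inter> ?L)"
    by (rule card_Un_Int) (use fin in auto)
  moreover have "?U \<union> ?L = {d. d dvd M\<^sup>2}" by auto
  moreover have "?U \<inter> ?L = {M}" by (auto simp: power2_eq_square)
  ultimately show ?thesis by simp
qed

lemma three_sorted:
  fixes V :: "nat set"
  assumes "card V = 3"
  obtains q r s where "V = {q, r, s}" "q < r" "r < s"
proof -
  obtain x y z where V: "V = {x, y, z}" "x \<noteq> y" "y \<noteq> z" "x \<noteq> z"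
    using assms by (auto simp: card_3_iff)
  then consider "x < y \<and> y < z" | "x < z \<and> z < y" | "y < x \<and> x < z" | "y < z \<and> z < x"
    | "z < x \<and> x < y" | "z < y \<and> y < x" by linarith
  then show ?thesis using V that by cases (auto simp: insert_commute)
qed

lemma two_sorted:
  fixes V :: "nat set"
  assumes "card V = 2"
  obtains r s where "V = {r, s}" "r < s"
proof -
  obtain x y where "V = {x, y}" "x \<noteq> y" using assms by (auto simp: card_2_iff)
  then show ?thesis using that[of x y] that[of y x] by (metis insert_commute nat_neq_iff)
qed

text \<open>A divisor \<open>d\<close> of \<open>M\<^sup>2\<close> with \<open>M\<close> squarefree is recorded by its ratio to \<open>M\<close>, a quotient
  \<open>x/y\<close> of coprime divisors of \<open>M\<close>.\<close>

lemma prime_square_divisor_ratio: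
  assumes "prime (p :: nat)" "d dvd p\<^sup>2"
  shows "\<exists>x y. d * y = p * x \<and> (x, y) \<in> {(1, p), (1, 1), (p, 1)}"
proof -
  obtain i where "i \<le> 2" "d = p ^ i" using assms divides_primepow_nat by blast
  then consider "d = 1" | "d = p" | "d = p * p" by (auto simp: le_Suc_eq numeral_2_eq_2)
  then show ?thesis
  proof cases
    case 1
    then show ?thesis by (intro exI[of _ 1] exI[of _ p]) simp
  next
    case 2
    then show ?thesis by (intro exI[of _ 1]) simp
  next
    case 3
    then show ?thesis by (intro exI[of _ p] exI[of _ 1]) simp
  qed
qed

text \<open>Of the 27 quotients \<open>d/M\<close> for \<open>M = q r s\<close>, those that can be
  at least 1 when \<open>q < r < s\<close>. Only the order of \<open>s\<close> and
  \<open>q r\<close> is undecided, so that quotient appears together with its inverse.\<close>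

definition ratios3 :: "nat \<Rightarrow> nat \<Rightarrow> nat \<Rightarrow> (nat \<times> nat) list" where
  "ratios3 q r s = [(q * r * s, 1), (r * s, 1), (r * s, q), (q * s, 1), (s, 1), (s, q), (q * r, 1),
    (r, 1), (r, q), (q, 1), (1, 1), (s, r), (q * s, r), (s, q * r), (q * r, s)]"

lemma divisor_ratio3:
  assumes pr: "prime q" "prime r" "prime s" and lt: "q < r" "r < s"
    and d: "d dvd (q * r * s)\<^sup>2" "q * r * s \<le> d"
  shows "\<exists>(x, y)\<in>set (ratios3 q r s). d * y = q * r * s * x \<and> 0 < y"
proof -
  have pos: "0 < q" "0 < r" "0 < s" "1 < q" "1 < r" "1 < s" using pr prime_gt_1_nat prime_gt_0_nat by blast+
  obtain a b c where abc: "d = a * b * c" "a dvd q\<^sup>2" "b dvd r\<^sup>2" "c dvd s\<^sup>2"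
    using d(1) division_decomp[of d "q\<^sup>2 * r\<^sup>2" "s\<^sup>2"] division_decomp[of _ "q\<^sup>2" "r\<^sup>2"]
    by (metis power_mult_distrib)
  obtain x1 y1 where 1: "a * y1 = q * x1" "(x1, y1) \<in> {(1, q), (1, 1), (q, 1)}"
    using prime_square_divisor_ratio[OF pr(1) abc(2)] by blast
  obtain x2 y2 where 2: "b * y2 = r * x2" "(x2, y2) \<in> {(1, r), (1, 1), (r, 1)}"
    using prime_square_divisor_ratio[OF pr(2) abc(3)] by blast
  obtain x3 y3 where 3: "c * y3 = s * x3" "(x3, y3) \<in> {(1, s), (1, 1), (s, 1)}"
    using prime_square_divisor_ratio[OF pr(3) abc(4)] by blast
  let ?x = "x1 * x2 * x3" and ?y = "y1 * y2 * y3"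
  have "d * ?y = (a * y1) * (b * y2) * (c * y3)" by (simp add: abc mult_ac)
  also have "\<dots> = q * r * s * ?x" unfolding 1 2 3 by (simp add: mult_ac)
  finally have e: "d * ?y = q * r * s * ?x" .
  have y: "0 < ?y" using 1 2 3 pos by auto
  have "q * r * s * ?y \<le> d * ?y" using d(2) by (rule mult_le_mono1)
  then have le: "?y \<le> ?x" unfolding e using pos by simp
  have mono: "1 * s \<le> r * s" "1 * s \<le> q * s" "1 * r \<le> q * r" "1 * (r * s) \<le> q * (r * s)"
    using pos by (intro mult_le_mono1; simp)+
  \<comment> \<open>These twelve comparisons refute exactly the quotients missing from
    \<open>ratios3\<close>, namely those below 1.\<close>
  have "\<not> q \<le> 1" "\<not> r \<le> 1" "\<not> s \<le> 1" "\<not> q * r \<le> 1" "\<not> q * s \<le> 1" "\<not> r * s \<le> 1"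
    "\<not> q * r * s \<le> 1" "\<not> r \<le> q" "\<not> s \<le> q" "\<not> s \<le> r" "\<not> r * s \<le> q" "\<not> q * s \<le> r"
    using lt pos mono unfolding mult.assoc by linarith+
  moreover have "x1 = 1 \<and> y1 = q \<or> x1 = 1 \<and> y1 = 1 \<or> x1 = q \<and> y1 = 1" using 1(2) by auto
  moreover have "x2 = 1 \<and> y2 = r \<or> x2 = 1 \<and> y2 = 1 \<or> x2 = r \<and> y2 = 1" using 2(2) by auto
  moreover have "x3 = 1 \<and> y3 = s \<or> x3 = 1 \<and> y3 = 1 \<or> x3 = s \<and> y3 = 1" using 3(2) by auto
  ultimately have "(?x, ?y) \<in> set (ratios3 q r s)"
    using le by (elim disjE conjE) (simp_all add: ratios3_def)
  then show ?thesis using e y by blast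
qed

text \<open>Quotients below 1 are kept here, since the additional prime factor \<open>Q\<close> may
  lift them above 1.\<close>

definition ratios2 :: "nat \<Rightarrow> nat \<Rightarrow> (nat \<times> nat) list" where
  "ratios2 r s = [(r * s, 1), (r, 1), (s, 1), (1, 1), (s, r), (r, s), (1, r), (1, s), (1, r * s)]"

lemma divisor_ratio2:
  assumes pr: "prime Q" "prime r" "prime s"
    and d: "d dvd Q * (r * s)\<^sup>2"
  shows "\<exists>(x, y)\<in>set (ratios2 r s @ map (\<lambda>(x, y). (Q * x, y)) (ratios2 r s)).
    d * y = r * s * x \<and> 0 < y"
proof -
  have pos: "0 < Q" "0 < r" "0 < s" using pr prime_gt_0_nat by blast+
  obtain a b c where abc: "d = a * b * c" "a dvd Q" "b dvd r\<^sup>2" "c dvd s\<^sup>2"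
    using d division_decomp[of d "Q * r\<^sup>2" "s\<^sup>2"] division_decomp[of _ "Q" "r\<^sup>2"]
    by (metis power_mult_distrib mult.assoc)
  have a: "a = 1 \<or> a = Q" using abc(2) pr(1) by (auto simp: prime_nat_iff)
  obtain x2 y2 where 2: "b * y2 = r * x2" "(x2, y2) \<in> {(1, r), (1, 1), (r, 1)}"
    using prime_square_divisor_ratio[OF pr(2) abc(3)] by blast
  obtain x3 y3 where 3: "c * y3 = s * x3" "(x3, y3) \<in> {(1, s), (1, 1), (s, 1)}"
    using prime_square_divisor_ratio[OF pr(3) abc(4)] by blast
  have "d * (y2 * y3) = a * (b * y2) * (c * y3)" by (simp add: abc mult_ac)
  also have "\<dots> = r * s * (a * (x2 * x3))" unfolding 2 3 by (simp add: mult_ac)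
  finally have e: "d * (y2 * y3) = r * s * (a * (x2 * x3))" .
  moreover have "0 < y2 * y3" using 2 3 pos by auto
  moreover have in9: "(x2 * x3, y2 * y3) \<in> set (ratios2 r s)"
  proof -
    have "x2 = 1 \<and> y2 = r \<or> x2 = 1 \<and> y2 = 1 \<or> x2 = r \<and> y2 = 1" using 2(2) by auto
    moreover have "x3 = 1 \<and> y3 = s \<or> x3 = 1 \<and> y3 = 1 \<or> x3 = s \<and> y3 = 1" using 3(2) by auto
    ultimately show ?thesis by (elim disjE conjE) (simp_all add: ratios2_def)
  qed
  moreover have "(a * (x2 * x3), y2 * y3) \<in> set (ratios2 r s @ map (\<lambda>(x, y). (Q * x, y)) (ratios2 r s))"
    using a in9 by force
  ultimately show ?thesis by blast
qed

text \<open>The primes are unknown, so quotients might coincide, which only improves the bound.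
  Written as a sum of 0/1 terms, the count can be reduced entry by entry with linear
  arithmetic.\<close>

lemma card_le_ratio_count:
  fixes f :: "'a \<Rightarrow> nat"
  assumes "inj_on f F"
    and "\<And>r. r \<in> F \<Longrightarrow> \<exists>(x, y)\<in>set L. f r * y = M * x \<and> 0 < y \<and> P x y"
  shows "card F \<le> (\<Sum>(x, y)\<leftarrow>L. if P x y then 1 else 0)"
proof -
  let ?L = "filter (\<lambda>(x, y). P x y) L"
  have "f ` F \<subseteq> (\<lambda>(x, y). M * x div y) ` set ?L"
  proof (rule image_subsetI)
    fix r assume "r \<in> F"
    then obtain x y where xy: "(x, y) \<in> set L" "f r * y = M * x" "0 < y" "P x y" using assms(2) by blast
    then have "f r = M * x div y" by (metis nonzero_mult_div_cancel_right neq0_conv)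
    then show "f r \<in> (\<lambda>(x, y). M * x div y) ` set ?L" using xy by force
  qed
  then have "card (f ` F) \<le> card ((\<lambda>(x, y). M * x div y) ` set ?L)" by (rule card_mono[rotated]) simp
  also have "\<dots> \<le> card (set ?L)" by (rule card_image_le) simp
  also have "\<dots> \<le> length ?L" by (rule card_length)
  also have "length ?L = (\<Sum>(x, y)\<leftarrow>L. if P x y then 1 else 0)" by (induction L) auto
  finally show ?thesis using assms(1) by (simp add: card_image)
qed

section \<open>Counting sides prime to a given prime\<close>

context equal_area_tiling
begin

text \<open>Meant for a prime \<open>p\<close> dividing the area exactly once: then it divides
  exactly one side of each tile, and this is the other one.\<close>

definition free_side :: "nat \<Rightarrow> 'a \<Rightarrow> nat" where
  "free_side p r = (if p dvd w r then h r else w r)"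

definition other_side :: "nat \<Rightarrow> 'a \<Rightarrow> nat" where
  "other_side p r = (if p dvd w r then w r else h r)"

lemma free_times_other: "r \<in> F \<Longrightarrow> free_side p r * other_side p r = A"
  using area by (simp add: free_side_def other_side_def mult.commute)

lemma free_side_cases: "free_side p r = w r \<or> free_side p r = h r"
  by (simp add: free_side_def)

lemma inj_free_side: "inj_on (free_side p) F"
  by (rule inj_on_side) (rule free_side_cases)

text \<open>Substitute for \<open>free_side\<close> when the area is a square: the longer side again
  lies in the upper half of the divisors of \<open>M^2\<close>.\<close>

lemma max_side_of_square:
  assumes "A = M\<^sup>2" "r \<in> F"
  shows "max (w r) (h r) dvd M\<^sup>2" "M \<le> max (w r) (h r)"
proof -
  have wh: "w r * h r = M\<^sup>2" using area assms by simp
  then show "max (w r) (h r) dvd M\<^sup>2" unfolding max_def by (metis dvd_triv_left dvd_triv_right)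
  show "M \<le> max (w r) (h r)"
  proof (rule ccontr)
    assume "\<not> M \<le> max (w r) (h r)"
    then have "w r * h r < M * M" by (intro mult_strict_mono') auto
    then show False using wh by (simp add: power2_eq_square)
  qed
qed

lemma free_side_dvd:
  assumes p: "prime p" "A = p * B" "\<not> p dvd B" and r: "r \<in> F"
  shows "free_side p r dvd B" "\<not> p dvd free_side p r"
proof -
  have "free_side p r dvd B \<and> \<not> p dvd free_side p r"
  proof (cases "p dvd w r")
    case True
    then obtain w' where w': "w r = p * w'" by blast
    then have "p * (w' * h r) = p * B" using area[OF r] p by (simp add: mult.assoc)
    then have "w' * h r = B" using p(1) prime_gt_0_nat by simp
    then have "h r dvd B" by (metis dvd_triv_right)
    then show ?thesis using True p(3) dvd_trans by (auto simp: free_side_def)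
  next
    case False
    then have "coprime (w r) p" using p(1) by (simp add: coprime_commute prime_imp_coprime)
    moreover have "w r dvd p * B" using area[OF r] p(2) by (metis dvd_triv_left)
    ultimately have "w r dvd B" by (simp add: coprime_dvd_mult_right_iff)
    then show ?thesis using False by (simp add: free_side_def)
  qed
  then show "free_side p r dvd B" "\<not> p dvd free_side p r" by auto
qed

lemma card_le_free_divisors:
  assumes p: "prime p" "A = p * B" "\<not> p dvd B"
  shows "card F \<le> card {d. d dvd B}"
proof -
  have "B > 0" using area_pos p(2) by (metis mult_is_0 neq0_conv)
  then show ?thesis
    by (intro card_inj_on_le[OF inj_free_side[of p]]) (use free_side_dvd[OF p] in auto)
qed

lemma width_ge:
  assumes "A = M * c" and r: "r \<in> F" shows "M \<le> w r"
proof -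
  have "h r \<le> c" using equal_area_tiling.w_le[OF dual r] .
  then have "M * c \<le> w r * c" using area[OF r] assms(1) by (metis mult_le_mono2)
  moreover have "c > 0" using assms(1) area_pos by (cases c) auto
  ultimately show ?thesis by simp
qed

text \<open>Unless its row is \<open>{r}\<close>, it contains a second tile, of width at least
  \<open>M\<close> because its height is at most \<open>c\<close>.\<close>

lemma width_gap:
  assumes "A = M * c" and r: "r \<in> F" shows "w r = a \<or> w r + M \<le> a"
proof (rule disjCI)
  assume gap: "\<not> w r + M \<le> a"
  obtain R where R: "\<mu> R \<noteq> 0" "r \<in> R" using row_exists[OF r] by blast
  have "R = {r}"
  proof (rule ccontr)
    assume "R \<noteq> {r}"
    then obtain s where s: "s \<in> R" "s \<noteq> r" using R by blast
    have "sum w {r, s} \<le> sum w R" by (rule sum_mono2) (use R s finite_row in auto)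
    then have "w r + w s \<le> a" using s row_sum[OF R(1)] by simp
    moreover have "M \<le> w s" using width_ge[OF assms(1)] s row_subset[OF R(1)] by blast
    ultimately show False using gap by simp
  qed
  then show "w r = a" using row_sum[OF R(1)] by simp
qed

text \<open>An odd number is only a sum of an odd number of odd sides, so a row without a strip has three tiles.\<close>
lemma width_gap_odd:
  assumes "A = M * c" "odd A" "odd a" and r: "r \<in> F" shows "w r = a \<or> w r + 2 * M \<le> a"
proof (rule disjCI)
  assume gap: "\<not> w r + 2 * M \<le> a"
  have odd: "odd (w s)" if "s \<in> F" for s using area[OF that] assms(2) by (metis even_mult_iff)
  obtain R where R: "\<mu> R \<noteq> 0" "r \<in> R" using row_exists[OF r] by blast
  have RF: "R \<subseteq> F" by (rule row_subset[OF R(1)])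
  have "R = {r}"
  proof (rule ccontr)
    assume "R \<noteq> {r}"
    then obtain s where s: "s \<in> R" "s \<noteq> r" using R by blast
    have "R \<noteq> {r, s}"
    proof
      assume "R = {r, s}"
      then have "w r + w s = a" using s row_sum[OF R(1)] by simp
      then show False using odd[of r] odd[of s] s RF R assms(3) by (metis even_add subsetD)
    qed
    then obtain t where t: "t \<in> R" "t \<noteq> r" "t \<noteq> s" using R s by blast
    have "w r + w s + w t \<le> a" using three_in_row_le[OF R, of s t] s t by simp
    moreover have "M \<le> w s" "M \<le> w t" using width_ge[OF assms(1)] s t RF by blast+
    ultimately show False using gap by simp
  qed
  then show "w r = a" using row_sum[OF R(1)] by simp
qed

end

text \<open>The gap applies to both sides, giving \<open>d <= (p - g) M\<close> and
  \<open>p M^2 / d <= (p - g) M\<close>. The free side is never \<open>n\<close>, as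
  \<open>p\<close> does not divide it; if the other side is \<open>n\<close>, then
  \<open>d = M\<close>. The value of \<open>g\<close> is 1 in general, 2 when all sides are odd, and
  0 when only the first two conclusions are wanted.\<close>

lemma free_side_range:
  assumes E: "equal_area_tiling F w h A n n \<mu> \<nu>"
    and p: "prime p" "A = p * M\<^sup>2" "n = p * M" "\<not> p dvd M"
    and gap: "\<And>r. r \<in> F \<Longrightarrow> w r = n \<or> w r + g * M \<le> n" "\<And>r. r \<in> F \<Longrightarrow> h r = n \<or> h r + g * M \<le> n"
    and r: "r \<in> F"
  defines "d \<equiv> equal_area_tiling.free_side w h p r"
  shows "d dvd M\<^sup>2" "M \<le> d" "d = M \<or> p * M \<le> (p - g) * d \<and> d \<le> (p - g) * M"
proof -
  interpret equal_area_tiling F w h A n n \<mu> \<nu> by (rule E)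
  interpret D: equal_area_tiling F h w A n n \<nu> \<mu> by (rule dual)
  have pM: "\<not> p dvd M\<^sup>2" using p by (simp add: prime_dvd_power_iff)
  have d: "d dvd M\<^sup>2" "\<not> p dvd d" using free_side_dvd[OF p(1,2) pM r] by (simp_all add: d_def)
  then show "d dvd M\<^sup>2" by simp
  have Mpos: "M > 0" using p(4) by (cases M) auto
  have An: "A = M * n" using p by (simp add: power2_eq_square)
  show "M \<le> d"
    using free_side_cases[of p r] width_ge[OF An r] D.width_ge[OF An r] unfolding d_def by auto
  have "d \<noteq> n" using d(2) p(3) by auto
  then have "d + g * M \<le> n" using free_side_cases[of p r] gap[OF r] by (auto simp: d_def)
  then have le: "d \<le> (p - g) * M" using p(3) by (simp add: diff_mult_distrib)
  define e where "e = other_side p r"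
  have de: "d * e = p * M * M" using free_times_other[OF r, of p] p(2) by (simp add: d_def e_def power2_eq_square)
  have "e = w r \<or> e = h r" by (simp add: e_def other_side_def)
  then have "e = n \<or> e + g * M \<le> n" using gap[OF r] by auto
  then show "d = M \<or> p * M \<le> (p - g) * d \<and> d \<le> (p - g) * M"
  proof
    assume "e = n"
    then have "d * (p * M) = M * (p * M)" using de p(3) by (simp add: mult_ac)
    then show ?thesis using Mpos p(1) prime_gt_0_nat by simp
  next
    assume "e + g * M \<le> n"
    then have "e \<le> (p - g) * M" using p(3) by (simp add: diff_mult_distrib)
    then have "d * e \<le> d * ((p - g) * M)" by (rule mult_le_mono2)
    then have "(p * M) * M \<le> ((p - g) * d) * M" unfolding de by (simp add: mult_ac)
    then have "p * M \<le> (p - g) * d" using Mpos by simp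
    then show ?thesis using le by simp
  qed
qed

lemma free_side_ratio:
  assumes E: "equal_area_tiling F w h A n n \<mu> \<nu>"
    and pr: "prime p" "prime q" "prime r" "prime s" "q < r" "r < s" "p \<notin> {q, r, s}"
    and A: "A = p * (q * r * s)\<^sup>2" "n = p * (q * r * s)"
    and gap: "\<And>r'. r' \<in> F \<Longrightarrow> w r' = n \<or> w r' + g * (q * r * s) \<le> n"
      "\<And>r'. r' \<in> F \<Longrightarrow> h r' = n \<or> h r' + g * (q * r * s) \<le> n"
    and t: "t \<in> F"
  shows "\<exists>(x, y)\<in>set (ratios3 q r s). equal_area_tiling.free_side w h p t * y = q * r * s * x \<and> 0 < y \<and>
    (x = y \<or> p * y \<le> (p - g) * x \<and> x \<le> (p - g) * y)"
proof -
  define M where "M = q * r * s"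
  define d where "d = equal_area_tiling.free_side w h p t"
  have "\<not> p dvd M"
    using pr unfolding M_def by (metis insert_iff prime_dvd_mult_iff primes_dvd_imp_eq)
  note range = free_side_range[OF E pr(1) A[folded M_def] this gap[folded M_def] t, folded d_def]
  have M: "M > 0" unfolding M_def using pr prime_gt_0_nat by simp
  obtain x y where xy: "(x, y) \<in> set (ratios3 q r s)" "d * y = M * x" "0 < y"
    using divisor_ratio3[OF pr(2-6), of d] range(1,2) unfolding M_def by blast
  have "x = y \<or> p * y \<le> (p - g) * x \<and> x \<le> (p - g) * y"
  proof (cases "d = M")
    case True
    then show ?thesis using xy M by simp
  next
    case False
    then have 1: "p * M \<le> (p - g) * d" and 2: "d \<le> (p - g) * M" using range(3) by auto
    have "M * x \<le> (p - g) * M * y" using mult_le_mono1[OF 2, of y] xy(2) by simp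
    then have "M * x \<le> M * ((p - g) * y)" by (simp add: mult_ac)
    moreover have "p * M * y \<le> (p - g) * (M * x)" using mult_le_mono1[OF 1, of y] xy(2) by (simp add: mult.assoc)
    then have "M * (p * y) \<le> M * ((p - g) * x)" by (simp add: mult_ac)
    ultimately show ?thesis using M by simp
  qed
  then show ?thesis using xy unfolding d_def M_def by blast
qed

text \<open>For concrete primes the surviving quotients evaluate to numbers. The chosen side may be
  horizontal or vertical, hence \<open>oriented\<close>.\<close>

lemma listed_of_ratios:
  assumes E: "equal_area_tiling F w h A n n \<mu> \<nu>"
    and f: "\<And>t. t \<in> F \<Longrightarrow> f t = w t \<or> f t = h t"
    and rat: "\<And>t. t \<in> F \<Longrightarrow> \<exists>(x, y)\<in>set L. f t * y = M * x \<and> 0 < y \<and> P x y"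
    and K: "\<forall>(x, y)\<in>set L. 0 < y \<and> P x y \<longrightarrow>
      (M * x div y, A div (M * x div y)) \<in> set (oriented K)"
  shows "listed_tiling F w h n n (oriented K)"
proof -
  interpret equal_area_tiling F w h A n n \<mu> \<nu> by (rule E)
  have "(w t, h t) \<in> set (oriented K)" if t: "t \<in> F" for t
  proof -
    obtain x y where xy: "(x, y) \<in> set L" "f t * y = M * x" "0 < y" "P x y" using rat[OF t] by blast
    then have "f t = M * x div y" by (metis nonzero_mult_div_cancel_right neq0_conv)
    then have fK: "(f t, A div f t) \<in> set (oriented K)" using K xy by auto
    have "A div w t = h t" "A div h t = w t"
      using area[OF t] w_pos[OF t] h_pos[OF t] by auto
    then have "(w t, h t) \<in> set (oriented K) \<or> (h t, w t) \<in> set (oriented K)"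
      using fK f[OF t] by auto
    then show ?thesis by (auto simp: oriented_def)
  qed
  then show ?thesis using E unfolding listed_tiling_def by blast
qed

section \<open>Excluding the tile numbers \<open>p\<close>, \<open>P Q\<close> and 9\<close>

lemma prime_less_19: "prime (p :: nat) \<Longrightarrow> p < 19 \<Longrightarrow> p \<in> {2, 3, 5, 7, 11, 13, 17}"
proof -
  assume p: "prime p" "p < 19"
  have "2 dvd p \<longrightarrow> p = 2" "3 dvd p \<longrightarrow> p = 3" "p \<noteq> 1" "p \<noteq> 0"
    using p(1) by (auto simp: prime_nat_iff)
  then show ?thesis using p(2) by simp presburger
qed

text \<open>All primes are odd here, so the gap doubles and quotients other than 1 lie between 7/5
  and 5, too narrow a range for seven tiles.\<close>

lemma odd_prime_tiling_impossible:
  assumes E: "equal_area_tiling F w h A n n \<mu> \<nu>"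
    and pr: "prime q" "prime r" "prime s" "q < r" "r < s" "7 \<notin> {q, r, s}"
    and A: "A = 7 * (q * r * s)\<^sup>2" "n = 7 * (q * r * s)"
    and card: "card F = 7" and q: "q \<noteq> 2"
  shows False
proof -
  interpret equal_area_tiling F w h A n n \<mu> \<nu> by (rule E)
  interpret D: equal_area_tiling F h w A n n \<nu> \<mu> by (rule dual)
  have odd: "odd q" "odd r" "odd s" using pr q prime_odd_nat[of q] prime_odd_nat[of r] prime_odd_nat[of s]
      prime_ge_2_nat[of q] by auto
  have An: "A = q * r * s * n" using A by (simp add: power2_eq_square)
  have odd': "odd A" "odd n" using A odd by auto
  have p7: "prime (7 :: nat)" by simp
  define c :: "nat \<Rightarrow> nat \<Rightarrow> nat" where "c = (\<lambda>x y. if x = y \<or> 7 * y \<le> (7 - 2) * x \<and> x \<le> (7 - 2) * y then 1 else 0)"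
  have "card F \<le> (\<Sum>(x, y)\<leftarrow>ratios3 q r s. if x = y \<or> 7 * y \<le> (7 - 2) * x \<and> x \<le> (7 - 2) * y then 1 else 0)"
    by (rule card_le_ratio_count[OF inj_free_side[of 7] free_side_ratio[OF E p7 pr A]])
      (use width_gap_odd[OF An odd'] D.width_gap_odd[OF An odd'] in auto)
  then have count: "7 \<le> c (q * r * s) 1 + c (r * s) 1 + c (r * s) q + c (q * s) 1 + c s 1 + c s q + c (q * r) 1
      + c r 1 + c r q + c q 1 + c 1 1 + c s r + c (q * s) r + c s (q * r) + c (q * r) s"
    using card unfolding c_def ratios3_def by (simp only: list.map sum_list.Cons sum_list.Nil prod.case)
  have le1: "c x y \<le> 1" for x y by (simp add: c_def)
  have zero: "c x y = 0" if "5 * y < x" for x y using that by (simp add: c_def)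
  have q3: "3 \<le> q" using q prime_ge_2_nat[OF pr(1)] by simp
  have r5: "5 \<le> r" using q3 pr(4) odd by (cases "r = 4") auto
  have s11: "11 \<le> s"
  proof (rule ccontr)
    assume "\<not> 11 \<le> s"
    then have "s \<in> {2, 3, 5, 7, 11, 13, 17}" using prime_less_19[OF pr(3)] by simp
    then show False using \<open>\<not> 11 \<le> s\<close> r5 pr(5,6) by auto
  qed
  have prods: "15 \<le> q * r" "33 \<le> q * s" "55 \<le> r * s"
    using mult_le_mono[OF q3 r5] mult_le_mono[OF q3 s11] mult_le_mono[OF r5 s11] by simp_all
  have "15 * 11 \<le> q * r * s" using mult_le_mono[OF prods(1) s11] by simp
  then have z1: "c (q * r * s) 1 = 0" by (intro zero) simp
  have z2: "c (r * s) 1 = 0" "c (q * s) 1 = 0" "c (q * r) 1 = 0" "c s 1 = 0"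
    using prods s11 by (auto intro!: zero)
  have "q * 11 \<le> r * s" using pr(4) s11 by (intro mult_le_mono) auto
  then have z3: "c (r * s) q = 0" using q3 by (intro zero) simp
  have sqr: "s \<noteq> q * r" using pr by (metis prime_product prime_gt_1_nat less_numeral_extra(4))
  then have excl: "c s (q * r) + c (q * r) s \<le> 1" by (auto simp: c_def)
  show False
  proof (cases "r = 5")
    case True
    then have q: "q = 3" using pr(4) q3 odd by (cases "q = 4") auto
    \<comment> \<open>Now \<open>s/q\<close> must count, so \<open>s <= 15\<close>, and so must one
      of \<open>s/15\<close> and \<open>15/s\<close>; but neither reaches 7/5 for
      \<open>11 <= s <= 15\<close>.\<close>
    have "c (q * s) r = 0" using True q s11 by (simp add: c_def)
    then have "c s q = 1 \<and> c s (q * r) + c (q * r) s = 1"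
      using count z1 z2 z3 excl le1[of s q] le1[of r 1] le1[of r q] le1[of q 1] le1[of 1 1] le1[of s r]
      by linarith
    then show False using True q s11 sqr by (auto simp: c_def split: if_splits)
  next
    case False
    then have "c r 1 = 0" using r5 by (simp add: c_def)
    \<comment> \<open>All remaining candidates are needed. They give
      \<open>7 q r <= 5 q s <= 25 r\<close>, hence \<open>q = 3\<close> and then
      \<open>r <= 10\<close>.\<close>
    then have "c s q = 1 \<and> c s r = 1 \<and> c (q * s) r = 1"
      using count z1 z2 z3 excl le1[of s q] le1[of r q] le1[of q 1] le1[of 1 1] le1[of s r] le1[of "q * s" r]
      by linarith
    then have b: "s \<le> 5 * q" "7 * r \<le> 5 * s" "q * s \<le> 5 * r"
    proof -
      have "s \<noteq> q" "s \<noteq> r" using pr by auto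
      moreover have "q * s \<noteq> r" using pr(4,5) q3 by (metis less_le_trans mult_le_mono1 nat_mult_1 less_irrefl not_less
        One_nat_def numeral_3_eq_3 Suc_leD le_trans)
      ultimately show "s \<le> 5 * q" "7 * r \<le> 5 * s" "q * s \<le> 5 * r"
        using \<open>c s q = 1 \<and> c s r = 1 \<and> c (q * s) r = 1\<close> by (simp_all add: c_def split: if_splits)
    qed
    have "q * (7 * r) \<le> q * (5 * s)" using b(2) by (rule mult_le_mono2)
    also have "\<dots> \<le> 5 * (5 * r)" using b(3) by simp
    finally have "7 * q * r \<le> 25 * r" by (simp add: mult_ac)
    then have "7 * q \<le> 25" using r5 by simp
    then have "q = 3" using q3 by simp
    then have "r \<le> 10" using b by simp
    then have "r \<in> {2, 3, 5, 7, 11, 13, 17}" using prime_less_19[OF pr(2)] by simp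
    then show False using \<open>r \<le> 10\<close> r5 False pr(6) by auto
  qed
qed

text \<open>At most fourteen of the fifteen quotients count, since \<open>s/(q r)\<close> and its
  inverse exclude each other. So \<open>p <= 14\<close>, quotients are at most 13,
  \<open>q r s\<close> and \<open>r s\<close> drop out, and \<open>p\<close> is 7 or 11.\<close>

lemma one_prime_tiling_impossible:
  assumes E: "equal_area_tiling F w h A n n \<mu> \<nu>"
    and pr: "prime p" "prime q" "prime r" "prime s" "q < r" "r < s" "p \<notin> {q, r, s}"
    and A: "A = p * (q * r * s)\<^sup>2" "n = p * (q * r * s)"
    and card: "card F = p" and p6: "6 \<le> p"
  shows False
proof -
  interpret equal_area_tiling F w h A n n \<mu> \<nu> by (rule E)
  interpret D: equal_area_tiling F h w A n n \<nu> \<mu> by (rule dual)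
  have An: "A = q * r * s * n" using A by (simp add: power2_eq_square)
  define P where "P = (\<lambda>x y. x = y \<or> p * y \<le> (p - 1) * x \<and> x \<le> (p - 1) * y)"
  define c :: "nat \<Rightarrow> nat \<Rightarrow> nat" where "c = (\<lambda>x y. if P x y then 1 else 0)"
  have ratio: "\<exists>(x, y)\<in>set (ratios3 q r s). free_side p t * y = q * r * s * x \<and> 0 < y \<and> P x y"
    if "t \<in> F" for t
    unfolding P_def
    by (rule free_side_ratio[OF E pr A _ _ that]) (use width_gap[OF An] D.width_gap[OF An] in auto)
  have "card F \<le> (\<Sum>(x, y)\<leftarrow>ratios3 q r s. if P x y then 1 else 0)"
    by (rule card_le_ratio_count[OF inj_free_side[of p] ratio])
  then have count: "p \<le> c (q * r * s) 1 + c (r * s) 1 + c (r * s) q + c (q * s) 1 + c s 1 + c s q + c (q * r) 1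
      + c r 1 + c r q + c q 1 + c 1 1 + c s r + c (q * s) r + c s (q * r) + c (q * r) s"
    using card unfolding c_def ratios3_def by (simp only: list.map sum_list.Cons sum_list.Nil prod.case)
  have le1: "c x y \<le> 1" for x y by (simp add: c_def)
  have big: "c x y = 0" if "(p - 1) * y < x" for x y
  proof -
    have "1 * y \<le> (p - 1) * y" using p6 by (intro mult_le_mono1) simp
    then have "x \<noteq> y" "\<not> x \<le> (p - 1) * y" using that by linarith+
    then show ?thesis by (simp add: c_def P_def)
  qed
  have small: "c x y = 0" if "x < y" for x y
  proof -
    have "(p - 1) * x \<le> p * x" by (intro mult_le_mono1) simp
    also have "\<dots> < p * y" using that p6 by simp
    finally show ?thesis using that by (simp add: c_def P_def)
  qed
  have q2: "2 \<le> q" and r3: "3 \<le> r" and s4: "4 \<le> s" using prime_ge_2_nat[OF pr(2)] pr(5,6) by linarith+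
  have "s \<noteq> 4" using prime_less_19[OF pr(4)] by auto
  then have s5: "5 \<le> s" using s4 by simp
  have prods: "6 \<le> q * r" "10 \<le> q * s" "15 \<le> r * s"
    using mult_le_mono[OF q2 r3] mult_le_mono[OF q2 s5] mult_le_mono[OF r3 s5] by simp_all
  have qrs: "30 \<le> q * r * s" using mult_le_mono[OF prods(1) s5] by simp
  have sqr: "s \<noteq> q * r" using pr by (metis prime_product prime_gt_1_nat less_numeral_extra(4))
  then have excl: "c s (q * r) + c (q * r) s \<le> 1"
    using small[of s "q * r"] small[of "q * r" s] le1[of s "q * r"] le1[of "q * r" s] by linarith
  note bounds = excl le1[of "q * r * s" 1] le1[of "r * s" 1] le1[of "r * s" q] le1[of "q * s" 1] le1[of s 1]
    le1[of s q] le1[of "q * r" 1] le1[of r 1] le1[of r q] le1[of q 1] le1[of 1 1] le1[of s r] le1[of "q * s" r]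
  have "p \<le> 14" using count bounds by linarith
  then have z0: "c (q * r * s) 1 = 0" "c (r * s) 1 = 0" using qrs prods by (auto intro!: big)
  then have "p \<le> 12" using count bounds by linarith
  moreover have "p \<in> {2, 3, 5, 7, 11, 13, 17}" using prime_less_19[OF pr(1)] \<open>p \<le> 14\<close> by simp
  ultimately consider "p = 7" | "p = 11" using p6 by auto
  then show False
  proof cases
    case 2
    \<comment> \<open>Twelve candidates for eleven tiles allow one failure. If \<open>q s\<close>
      fails, then \<open>q r <= 10\<close> and \<open>r s <= 10 q\<close> must hold, which turns out
      contradictory.\<close>
    have "q = 2 \<and> r = 3 \<and> s = 5"
    proof (cases "q * s \<le> 10")
      case True
      then have "q * 5 \<le> 10" using s5 by (meson le_trans mult_le_mono2)
      then have "q = 2" using q2 by simp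
      then show ?thesis using True s5 pr(5,6) r3 prime_less_19[OF pr(3)] by auto
    next
      case False
      then have "c (q * s) 1 = 0" using 2 by (intro big) simp
      then have "c (q * r) 1 = 1 \<and> c (r * s) q = 1" using count bounds z0 2 by linarith
      then have b: "q * r \<le> 10" "r * s \<le> 10 * q"
        using big[of 1 "q * r"] big[of q "r * s"] 2 by (auto simp: not_less[symmetric])
      have "q * 3 \<le> 10" using b(1) r3 by (meson le_trans mult_le_mono2)
      then have "q = 2 \<or> q = 3" using q2 by linarith
      then show ?thesis
      proof
        assume q: "q = 3"
        then have "r \<le> 3" using b(1) by simp
        then show ?thesis using q pr(5) by simp
      next
        assume q: "q = 2"
        then have "r * s \<le> 20" using b(2) by simp
        then have "3 * s \<le> 20" using r3 by (meson le_trans mult_le_mono1)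
        then have "s \<le> 5" using False q prime_less_19[OF pr(4)] by auto
        then show ?thesis using False q by simp
      qed
    qed
    then have "listed_tiling F w h 330 330 (oriented [(30, 330), (33, 300), (36, 275), (44, 225),
      (45, 220), (50, 198), (55, 180), (60, 165), (66, 150), (75, 132), (90, 110), (99, 100)])"
      using listed_of_ratios[OF E free_side_cases ratio, where K = "[(30, 330), (33, 300), (36, 275), (44, 225),
      (45, 220), (50, 198), (55, 180), (60, 165), (66, 150), (75, 132), (90, 110), (99, 100)]"] A 2
      by (simp add: P_def ratios3_def oriented_def)
    then show False using no_tiling_330_by_11 card 2 by blast
  next
    case 1
    have q: "q = 2"
    proof (rule ccontr)
      assume "q \<noteq> 2"
      then show False using odd_prime_tiling_impossible[OF E pr(2-6)] pr(7) A card 1 by auto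
    qed
    \<comment> \<open>With \<open>q = 2\<close> and quotients at most 6, ten candidates remain for
      seven tiles; a fourth failure is a contradiction in each case below.\<close>
    have z1: "c (q * s) 1 = 0" "c (r * s) q = 0" using prods q 1 by (auto intro!: big)
    have listed: "listed_tiling F w h (14 * (r * s)) (14 * (r * s)) (oriented K)"
      if "\<forall>(x, y)\<in>set (ratios3 2 r s). 0 < y \<and> (x = y \<or> 7 * y \<le> 6 * x \<and> x \<le> 6 * y) \<longrightarrow>
      (2 * r * s * x div y, 28 * (r * s)\<^sup>2 div (2 * r * s * x div y)) \<in> set (oriented K)" for K
    proof -
      have "n = 14 * (r * s)" "A = 28 * (r * s)\<^sup>2" using A q 1 by (simp_all add: power_mult_distrib)
      then show ?thesis
        using listed_of_ratios[OF E free_side_cases ratio, where K = K] that q 1 by (simp add: P_def)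
    qed
    have "r \<noteq> 7" "s \<noteq> 7" using pr(7) 1 by auto
    have "odd r" "odd s" using prime_odd_nat[OF pr(3)] prime_odd_nat[OF pr(4)] r3 s5 by auto
    consider "r = 3" | "r = 5" | "11 \<le> r"
    proof -
      have "r < 11 \<Longrightarrow> r = 3 \<or> r = 5" using prime_less_19[OF pr(3)] r3 \<open>r \<noteq> 7\<close> by auto
      then show ?thesis using that by linarith
    qed
    then show False
    proof cases
      case r: 1
      \<comment> \<open>Beyond 18 even \<open>s/3\<close> exceeds 6, and with it \<open>s\<close>,
        \<open>s/2\<close> and \<open>2 s/3\<close>.\<close>
      have "s \<le> 18"
      proof (rule ccontr)
        assume "\<not> s \<le> 18"
        then have "c s 1 = 0" "c s q = 0" "c s r = 0" "c (q * s) r = 0"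
          using r q 1 by (auto intro!: big)
        moreover have "c (q * r) s = 0" using r q \<open>\<not> s \<le> 18\<close> by (intro small) simp
        ultimately show False using count bounds le1[of s "q * r"] z0 z1 1 by linarith
      qed
      then have "s \<in> {2, 3, 5, 7, 11, 13, 17}" using prime_less_19[OF pr(4)] by simp
      then consider "s = 5" | "s = 11" | "s = 13" | "s = 17" using s5 \<open>s \<noteq> 7\<close> by auto
      then show False
      proof cases
        case s: 1
        have "listed_tiling F w h (14 * (r * s)) (14 * (r * s)) (oriented [(30, 210), (35, 180), (36, 175), (42, 150),
            (45, 140), (50, 126), (60, 105), (63, 100), (70, 90), (75, 84)])"
          by (rule listed) (simp add: r s ratios3_def oriented_def)
        then show False using no_tiling_210_by_7[of F w h] card 1 by (simp add: r s)
      next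
        case s: 2
        have "listed_tiling F w h (14 * (r * s)) (14 * (r * s)) (oriented [(66, 462), (77, 396), (84, 363), (99, 308),
            (121, 252), (126, 242), (132, 231), (154, 198)])"
          by (rule listed) (simp add: r s ratios3_def oriented_def)
        then show False using no_tiling_462_by_7[of F w h] card 1 by (simp add: r s)
      next
        case s: 3
        have "listed_tiling F w h (14 * (r * s)) (14 * (r * s)) (oriented [(78, 546), (91, 468), (117, 364), (126, 338),
            (156, 273), (169, 252), (182, 234)])"
          by (rule listed) (simp add: r s ratios3_def oriented_def)
        then show False using no_tiling_546_by_7[of F w h] card 1 by (simp add: r s)
      next
        case s: 4
        have "listed_tiling F w h (14 * (r * s)) (14 * (r * s)) (oriented [(102, 714), (119, 612), (126, 578), (153, 476),
            (204, 357), (238, 306), (252, 289)])"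
          by (rule listed) (simp add: r s ratios3_def oriented_def)
        then show False using no_tiling_714_by_7[of F w h] card 1 by (simp add: r s)
      qed
    next
      case r: 2
      have s11: "11 \<le> s"
      proof (rule ccontr)
        assume "\<not> 11 \<le> s"
        then show False using prime_less_19[OF pr(4)] r pr(6) \<open>s \<noteq> 7\<close> by auto
      qed
      then have z2: "c (q * r) 1 = 0" "c s 1 = 0" using r q 1 by (auto intro!: big)
      have z3: "c (q * r) s = 0" using r q s11 by (intro small) simp
      \<comment> \<open>Beyond 15 even \<open>2 s/5\<close> exceeds 6, and with it
        \<open>10\<close>, \<open>s\<close> and \<open>s/2\<close>.\<close>
      have "s \<le> 15"
      proof (rule ccontr)
        assume "\<not> s \<le> 15"
        then have "c s q = 0" "c (q * s) r = 0" using r q 1 by (auto intro!: big)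
        then show False using count bounds le1[of s "q * r"] z0 z1 z2 z3 1 by linarith
      qed
      then have "s \<in> {2, 3, 5, 7, 11, 13, 17}" using prime_less_19[OF pr(4)] by simp
      then consider "s = 11" | "s = 13" using s11 \<open>s \<le> 15\<close> by auto
      then show False
      proof cases
        case s: 1
        have "listed_tiling F w h (14 * (r * s)) (14 * (r * s)) (oriented [(110, 770), (140, 605), (154, 550), (175, 484),
            (220, 385), (242, 350), (275, 308)])"
          by (rule listed) (simp add: r s ratios3_def oriented_def)
        then show False using no_tiling_770_by_7[of F w h] card 1 by (simp add: r s)
      next
        case s: 2
        have "listed_tiling F w h (14 * (r * s)) (14 * (r * s)) (oriented [(130, 910), (169, 700), (175, 676), (182, 650),
            (260, 455), (325, 364), (338, 350)])"
          by (rule listed) (simp add: r s ratios3_def oriented_def)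
        then show False using no_tiling_910_by_7[of F w h] card 1 by (simp add: r s)
      qed
    next
      case r: 3
      then have "12 < s" using pr(6) \<open>odd s\<close> by (cases "s = 12") auto
      then have "c (q * r) 1 = 0" "c s 1 = 0" "c r 1 = 0" "c s q = 0"
        using r q 1 by (auto intro!: big)
      then show False using count bounds z0 z1 1 by linarith
    qed
  qed
qed

text \<open>The side prime to \<open>P\<close> may still contain \<open>Q\<close>, so each of the
  nine quotients also occurs multiplied by \<open>Q\<close>. Four of the eighteen are below 1, so
  \<open>P Q <= 14\<close> and \<open>Q = 2\<close>; five more then fall outside the range from 1 to
  \<open>P Q\<close>, so \<open>P = 3\<close>.\<close>

lemma two_prime_tiling_impossible:
  assumes E: "equal_area_tiling F w h A n n \<mu> \<nu>"
    and pr: "prime P" "prime Q" "prime r" "prime s" "Q < P" "r < s" "P \<notin> {r, s}" "Q \<notin> {r, s}"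
    and A: "A = P * (Q * (r * s)\<^sup>2)" "n = P * Q * (r * s)"
    and card: "card F = P * Q"
  shows False
proof -
  interpret equal_area_tiling F w h A n n \<mu> \<nu> by (rule E)
  interpret D: equal_area_tiling F h w A n n \<nu> \<mu> by (rule dual)
  have An: "A = r * s * n" using A by (simp add: power2_eq_square)
  have ndvd: "\<not> P dvd Q * (r * s)\<^sup>2"
    using pr by (metis insert_iff nat_neq_iff prime_dvd_mult_iff prime_dvd_power primes_dvd_imp_eq)
  define B where "B = (\<lambda>x y. y \<le> x \<and> x \<le> P * Q * y)"
  define L where "L = ratios2 r s @ map (\<lambda>(x, y). (Q * x, y)) (ratios2 r s)"
  have M: "0 < r * s" using pr prime_gt_0_nat by simp
  have ratio: "\<exists>(x, y)\<in>set L. free_side P t * y = r * s * x \<and> 0 < y \<and> B x y" if t: "t \<in> F" for t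
  proof -
    let ?d = "free_side P t"
    obtain x y where xy: "(x, y) \<in> set L" "?d * y = r * s * x" "0 < y"
      using divisor_ratio2[OF pr(2-4) free_side_dvd(1)[OF pr(1) A(1) ndvd t]] unfolding L_def by blast
    have "r * s \<le> ?d" "?d \<le> n"
      using free_side_cases[of P t] width_ge[OF An t] D.width_ge[OF An t] w_le[OF t] D.w_le[OF t] by auto
    then have "r * s * y \<le> ?d * y" "?d * y \<le> n * y" by (auto intro: mult_le_mono1)
    then have "r * s * y \<le> r * s * x" "r * s * x \<le> r * s * (P * Q * y)"
      unfolding xy(2) A(2) by (simp_all only: mult_ac)
    then show ?thesis using xy M unfolding B_def by auto
  qed
  define c :: "nat \<Rightarrow> nat \<Rightarrow> nat" where "c = (\<lambda>x y. if B x y then 1 else 0)"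
  have "card F \<le> (\<Sum>(x, y)\<leftarrow>L. if B x y then 1 else 0)"
    by (rule card_le_ratio_count[OF inj_free_side[of P] ratio])
  then have count: "P * Q \<le> c (r * s) 1 + c r 1 + c s 1 + c 1 1 + c s r + c r s + c 1 r + c 1 s + c 1 (r * s)
      + c (Q * (r * s)) 1 + c (Q * r) 1 + c (Q * s) 1 + c (Q * 1) 1 + c (Q * s) r + c (Q * r) s
      + c (Q * 1) r + c (Q * 1) s + c (Q * 1) (r * s)"
    using card unfolding c_def L_def ratios2_def
    by (simp only: list.map sum_list.Cons sum_list.Nil prod.case append.simps)
  have le1: "c x y \<le> 1" for x y by (simp add: c_def)
  have small: "c x y = 0" if "x < y" for x y using that by (simp add: c_def B_def)
  have big: "c x y = 0" if "P * Q * y < x" for x y using that by (simp add: c_def B_def)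
  have ge: "2 \<le> Q" "2 \<le> r" "3 \<le> s" "3 \<le> P" using pr prime_ge_2_nat[of Q] prime_ge_2_nat[of r] by linarith+
  have "6 \<le> r * s" using mult_le_mono[OF ge(2,3)] by simp
  then have z: "c r s = 0" "c 1 r = 0" "c 1 s = 0" "c 1 (r * s) = 0" using pr(6) ge by (auto intro!: small)
  note bounds = le1[of "r * s" 1] le1[of r 1] le1[of s 1] le1[of 1 1] le1[of s r]
    le1[of "Q * (r * s)" 1] le1[of "Q * r" 1] le1[of "Q * s" 1] le1[of "Q * 1" 1] le1[of "Q * s" r]
    le1[of "Q * r" s] le1[of "Q * 1" r] le1[of "Q * 1" s] le1[of "Q * 1" "r * s"]
  have PQ: "P * Q \<le> 14" using count bounds z by linarith
  have Q: "Q = 2"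
  proof (rule ccontr)
    assume "Q \<noteq> 2"
    then have Q3: "3 \<le> Q" using ge by simp
    then have "P \<noteq> 4" using prime_less_19[OF pr(1)] by auto
    then have "5 \<le> P" using Q3 pr(5) by simp
    then have "15 \<le> P * Q" using mult_le_mono[OF _ Q3, of 5 P] by simp
    then show False using PQ by simp
  qed
  have r3: "3 \<le> r" using ge pr(8) Q by simp
  have s4: "4 \<le> s" using r3 pr(6) by simp
  have "s \<noteq> 4" using prime_less_19[OF pr(4)] by auto
  then have s5: "5 \<le> s" using s4 by simp
  have rs: "15 \<le> r * s" using mult_le_mono[OF r3 s5] by simp
  have z2: "c (Q * 1) r = 0" "c (Q * 1) s = 0" "c (Q * 1) (r * s) = 0"
    using r3 s5 rs Q by (auto intro!: small)
  have z2': "c (Q * (r * s)) 1 = 0" "c (r * s) 1 = 0" using rs Q PQ by (auto intro!: big)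
  have "P * Q \<le> 9" using count bounds z z2 z2' by linarith
  then have P3: "P = 3" using Q ge(4) prime_less_19[OF pr(1)] by auto
  have r5: "5 \<le> r"
  proof -
    have "r \<noteq> 3" using pr(7) P3 by auto
    moreover have "r \<noteq> 4" using prime_less_19[OF pr(3)] by auto
    ultimately show ?thesis using r3 by simp
  qed
  have s7: "7 \<le> s"
  proof -
    have "s \<noteq> 6" using prime_less_19[OF pr(4)] by auto
    then show ?thesis using r5 pr(6) by simp
  qed
  have z3: "c s 1 = 0" "c (Q * s) 1 = 0" "c (Q * r) 1 = 0" using s7 r5 P3 Q by (auto intro!: big)
  have "P * Q = 6" using P3 Q by simp
  \<comment> \<open>Six candidates are left for six tiles. That \<open>r\<close> and
    \<open>2 r/s\<close> count means \<open>r <= 6\<close> and \<open>s <= 2 r\<close>, which fixes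
    both primes.\<close>
  then have "c r 1 = 1 \<and> c (Q * r) s = 1" using count bounds z z2 z2' z3 by linarith
  moreover have "B x y" if "c x y = 1" for x y using that by (cases "B x y") (simp_all add: c_def)
  ultimately have "B r 1" "B (Q * r) s" by blast+
  then have "r \<le> 6" "s \<le> 2 * r" using P3 Q by (simp_all add: B_def)
  then have r: "r = 5" using r5 prime_less_19[OF pr(3)] by auto
  have s: "s = 7"
  proof -
    have "s \<le> 10" using \<open>s \<le> 2 * r\<close> r by simp
    then have "s \<in> {2, 3, 5, 7, 11, 13, 17}" using prime_less_19[OF pr(4)] by simp
    then show ?thesis using s7 \<open>s \<le> 10\<close> by auto
  qed
  have "listed_tiling F w h 210 210
      (oriented [(35, 210), (42, 175), (49, 150), (50, 147), (70, 105), (75, 98)])"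
    using listed_of_ratios[OF E free_side_cases ratio, where K =
      "[(35, 210), (42, 175), (49, 150), (50, 147), (70, 105), (75, 98)]"] A P3 Q r s
    by (simp add: B_def L_def ratios2_def oriented_def)
  then show False using no_tiling_210_by_6 card P3 Q by fastforce
qed

text \<open>Longer sides lie between \<open>M\<close> and \<open>3 M\<close>. Seven of the fifteen
  quotients exceed 3, leaving eight for nine tiles.\<close>

lemma nine_tiling_impossible:
  assumes E: "equal_area_tiling F w h A n n \<mu> \<nu>"
    and pr: "prime q" "prime r" "prime s" "q < r" "r < s" "3 \<notin> {q, r, s}"
    and A: "A = (q * r * s)\<^sup>2" "n = 3 * (q * r * s)"
    and card: "card F = 9"
  shows False
proof -
  interpret equal_area_tiling F w h A n n \<mu> \<nu> by (rule E)
  interpret D: equal_area_tiling F h w A n n \<nu> \<mu> by (rule dual)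
  define M where "M = q * r * s"
  have M: "0 < M" using pr prime_gt_0_nat by (simp add: M_def)
  define f where "f = (\<lambda>t. max (w t) (h t))"
  have inj: "inj_on f F" by (rule inj_on_side) (simp add: f_def max_def)
  have ratio: "\<exists>(x, y)\<in>set (ratios3 q r s). f t * y = M * x \<and> 0 < y \<and> y \<le> x \<and> x \<le> 3 * y" if t: "t \<in> F" for t
  proof -
    have "f t dvd M\<^sup>2" and ge: "M \<le> f t"
      using max_side_of_square[OF _ t, of M] A(1) by (simp_all add: f_def M_def)
    then obtain x y where xy: "(x, y) \<in> set (ratios3 q r s)" "f t * y = M * x" "0 < y"
      using divisor_ratio3[OF pr(1-5), of "f t"] unfolding M_def by blast
    have "f t \<le> 3 * M" using w_le[OF t] D.w_le[OF t] A(2) by (simp add: f_def M_def)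
    then have "f t * y \<le> 3 * M * y" "M * y \<le> f t * y" using ge by (auto intro: mult_le_mono1)
    then have "M * x \<le> M * (3 * y)" "M * y \<le> M * x" unfolding xy(2) by (simp_all only: mult_ac)
    then show ?thesis using xy M by auto
  qed
  define c :: "nat \<Rightarrow> nat \<Rightarrow> nat" where "c = (\<lambda>x y. if y \<le> x \<and> x \<le> 3 * y then 1 else 0)"
  have "card F \<le> (\<Sum>(x, y)\<leftarrow>ratios3 q r s. if y \<le> x \<and> x \<le> 3 * y then 1 else 0)"
    by (rule card_le_ratio_count[OF inj ratio])
  then have count: "9 \<le> c (q * r * s) 1 + c (r * s) 1 + c (r * s) q + c (q * s) 1 + c s 1 + c s q + c (q * r) 1
      + c r 1 + c r q + c q 1 + c 1 1 + c s r + c (q * s) r + c s (q * r) + c (q * r) s"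
    using card unfolding c_def ratios3_def by (simp only: list.map sum_list.Cons sum_list.Nil prod.case)
  have le1: "c x y \<le> 1" for x y by (simp add: c_def)
  have big: "c x y = 0" if "3 * y < x" for x y using that by (simp add: c_def)
  have ge: "2 \<le> q" "4 \<le> r" "5 \<le> s" using prime_ge_2_nat[OF pr(1)] pr(4-6) by auto
  have prods: "8 \<le> q * r" "10 \<le> q * s" "20 \<le> r * s"
    using mult_le_mono[OF ge(1,2)] mult_le_mono[OF ge(1,3)] mult_le_mono[OF ge(2,3)] by simp_all
  have "8 * 5 \<le> q * r * s" using mult_le_mono[OF prods(1) ge(3)] by simp
  then have "c (q * r * s) 1 = 0" by (intro big) simp
  moreover have "c (r * s) 1 = 0" "c (q * s) 1 = 0" "c (q * r) 1 = 0" "c s 1 = 0" "c r 1 = 0"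
    using prods ge by (auto intro!: big)
  moreover have "q * 5 \<le> r * s" using pr(4) ge by (intro mult_le_mono) auto
  then have "c (r * s) q = 0" using ge by (intro big) simp
  ultimately show False
    using count le1[of s q] le1[of r q] le1[of q 1] le1[of 1 1] le1[of s r] le1[of "q * s" r]
      le1[of s "q * r"] le1[of "q * r" s] by linarith
qed

section \<open>The theorem\<close>

lemma prime_not_dvd_prod:
  fixes S :: "nat set"
  assumes "prime p" "finite S" "\<And>q. q \<in> S \<Longrightarrow> prime q" "p \<notin> S"
  shows "\<not> p dvd \<Prod>S"
proof
  assume "p dvd \<Prod>S"
  then obtain q where "q \<in> S" "p dvd q" using assms(1,2) by (auto simp: prime_dvd_prod_iff)
  then show False using primes_dvd_imp_eq[of p q] assms by blast
qed

lemma squarefree_tiling_impossible: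
  fixes S :: "nat set"
  assumes E: "equal_area_tiling F w h A n n \<mu> \<nu>" and two: "2 \<le> card F"
    and S: "finite S" "\<And>p. p \<in> S \<Longrightarrow> prime p" "card S \<le> 4" "n = \<Prod>S"
  shows False
proof -
  interpret equal_area_tiling F w h A n n \<mu> \<nu> by (rule E)
  interpret D: equal_area_tiling F h w A n n \<nu> \<mu> by (rule dual)
  define k where "k = card F"
  have kA: "k * A = n\<^sup>2" using card_times_area by (simp add: k_def power2_eq_square)
  have k6: "6 \<le> k"
  proof (rule ccontr)
    assume "\<not> 6 \<le> k"
    then have "card F \<le> 4 \<or> card F = 5" by (auto simp: k_def)
    then show False using small_tiling_impossible[OF E two] five_square_tiling_impossible[OF E] by blast
  qed
  have "k dvd (\<Prod>S)\<^sup>2" using kA S(4) by (metis dvd_triv_left)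
  then obtain T U where TU: "T \<subseteq> S" "U \<subseteq> S" "T \<inter> U = {}" and k: "k = \<Prod>T * (\<Prod>U)\<^sup>2"
    using squarefree_square_divisor[OF S(1,2)] by blast
  define V where "V = S - (T \<union> U)"
  have fin: "finite T" "finite U" "finite V" using TU S(1) finite_subset by (auto simp: V_def)
  have prm: "prime p" if "p \<in> T \<union> U \<union> V" for p using that TU S(2) by (auto simp: V_def)
  have ge2: "2 \<le> p" if "p \<in> T \<union> U \<union> V" for p using prm[OF that] prime_ge_2_nat by blast
  have gt0: "0 < p" if "p \<in> T \<union> U \<union> V" for p using ge2[OF that] by simp
  have S_split: "S = V \<union> (T \<union> U)" using TU by (auto simp: V_def)
  have disj: "V \<inter> T = {}" "V \<inter> U = {}" by (auto simp: V_def)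
  have n: "n = \<Prod>V * (\<Prod>T * \<Prod>U)"
    unfolding S(4) S_split using fin disj TU(3) by (subst prod.union_disjoint; auto simp: prod.union_disjoint)
  have card4: "card V + (card T + card U) \<le> 4"
  proof -
    have "card S = card V + (card T + card U)"
      unfolding S_split using fin disj TU(3) by (subst card_Un_disjoint; auto simp: card_Un_disjoint)
    then show ?thesis using S(3) by simp
  qed
  have pos: "0 < \<Prod>T" "0 < \<Prod>U" "0 < \<Prod>V" using gt0 by (auto intro!: prod_pos)
  have A: "A = \<Prod>T * (\<Prod>V)\<^sup>2"
  proof -
    have "k * (\<Prod>T * (\<Prod>V)\<^sup>2) = n\<^sup>2" unfolding n k by (simp add: power2_eq_square mult_ac)
    then have "k * A = k * (\<Prod>T * (\<Prod>V)\<^sup>2)" using kA by simp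
    then show ?thesis using k6 by simp
  qed
  define M where "M = \<Prod>V"
  have divM: "card {d. d dvd M\<^sup>2} \<le> 3 ^ card V"
    using card_divisors_prod_le[of V 2] fin prm unfolding M_def by simp
  have upper: "2 * card {d. d dvd M\<^sup>2 \<and> M \<le> d} \<le> 3 ^ card V + 1"
    using card_upper_divisors[of M] pos divM by (simp add: M_def)
  have factTU: "fact (card T + card U + 1) \<le> \<Prod>T * \<Prod>U"
  proof -
    have "fact (card (T \<union> U) + 1) \<le> \<Prod>(T \<union> U)" using prod_ge_fact[of "T \<union> U"] fin ge2 by auto
    then show ?thesis using fin TU(3) by (simp add: card_Un_disjoint prod.union_disjoint)
  qed
  have TUk: "\<Prod>T * \<Prod>U * \<Prod>U = k" by (simp add: k power2_eq_square mult_ac)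
  have Tk: "\<Prod>T * \<Prod>U \<le> k" using TUk pos by (metis One_nat_def Suc_leI mult.right_neutral mult_le_mono2)
  \<comment> \<open>Without \<open>p\<close>, the area leaves two exponents for each other prime of
    \<open>T\<close> and three for each prime of \<open>V\<close>.\<close>
  have free: "k \<le> 2 ^ (card T - 1) * 3 ^ card V" if p: "p \<in> T" for p
  proof -
    let ?B = "\<Prod>(T - {p}) * M\<^sup>2"
    have AB: "A = p * ?B" using A p fin by (simp add: M_def prod.remove mult.assoc)
    have pT: "\<not> p dvd \<Prod>(T - {p})" by (rule prime_not_dvd_prod) (use p prm fin in auto)
    have pV: "\<not> p dvd \<Prod>V" by (rule prime_not_dvd_prod) (use p prm fin disj in auto)
    have "prime p" using p prm by simp
    then have "\<not> p dvd ?B" using pT pV by (auto simp: M_def prime_dvd_mult_iff prime_dvd_power_iff)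
    then have "k \<le> card {d. d dvd ?B}" using card_le_free_divisors[OF \<open>prime p\<close> AB] by (simp add: k_def)
    also have "\<dots> \<le> card {d. d dvd \<Prod>(T - {p})} * card {d. d dvd M\<^sup>2}"
      by (rule card_divisors_mult_le) (use pos gt0 in \<open>auto intro!: prod_pos simp: M_def\<close>)
    also have "\<dots> \<le> 2 ^ (card T - 1) * 3 ^ card V"
      using card_divisors_prod_le[of "T - {p}" 1] fin prm p divM
      by (intro mult_le_mono) (auto simp: numeral_2_eq_2)
    finally show ?thesis .
  qed
  consider "card T = 0" | "card T = 1" | "card T = 2" | "3 \<le> card T" by linarith
  then show False
  proof cases
    case 1
    then have T: "T = {}" using fin by simp
    then have AM: "A = M\<^sup>2" and kU: "k = (\<Prod>U)\<^sup>2" using A k by (simp_all add: M_def)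
    have inj: "inj_on (\<lambda>t. max (w t) (h t)) F" by (rule inj_on_side) (simp add: max_def)
    have "k \<le> card {d. d dvd M\<^sup>2 \<and> M \<le> d}"
      unfolding k_def
    proof (rule card_inj_on_le[OF inj])
      show "(\<lambda>t. max (w t) (h t)) ` F \<subseteq> {d. d dvd M\<^sup>2 \<and> M \<le> d}"
        using max_side_of_square[OF AM] by blast
      show "finite {d. d dvd M\<^sup>2 \<and> M \<le> d}" using pos by (simp add: M_def)
    qed
    then have kV: "2 * k \<le> 3 ^ card V + 1" using upper by linarith
    have "U \<noteq> {}" using k6 kU by auto
    then have "1 \<le> card U" using fin by (simp add: Suc_leI card_gt_0_iff)
    then have V3: "card V \<le> 3" using card4 by simp
    then have "(3 :: nat) ^ card V \<le> 3 ^ 3" by (intro power_increasing) auto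
    then have k14: "k \<le> 14" using kV by simp
    \<comment> \<open>\<open>k\<close> is a square between 6 and 14.\<close>
    have U3: "\<Prod>U = 3"
    proof -
      have "\<Prod>U < 4"
      proof (rule ccontr)
        assume "\<not> \<Prod>U < 4"
        then have "4 * 4 \<le> \<Prod>U * \<Prod>U" by (intro mult_le_mono) auto
        then show False using kU k14 by (simp add: power2_eq_square)
      qed
      moreover have "\<not> \<Prod>U \<le> 2"
      proof
        assume "\<Prod>U \<le> 2"
        then have "\<Prod>U * \<Prod>U \<le> 2 * 2" by (intro mult_le_mono) auto
        then show False using kU k6 by (simp add: power2_eq_square)
      qed
      ultimately show ?thesis by simp
    qed
    then have k9: "k = 9" using kU by simp
    have "card V = 3"
    proof (rule ccontr)
      assume "card V \<noteq> 3"
      then have "(3 :: nat) ^ card V \<le> 3 ^ 2" using V3 by (intro power_increasing) auto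
      then show False using kV k9 by simp
    qed
    moreover have "3 \<notin> V"
    proof -
      have "(3 :: nat) \<in> U"
      proof -
        have "fact (card U + 1) \<le> (3 :: nat)" using prod_ge_fact[of U] fin ge2 U3 by auto
        then have "card U < 2"
        proof -
          have "fact 3 \<le> (fact (card U + 1) :: nat)" if "2 \<le> card U" using that by (intro fact_mono) simp
          then show ?thesis using \<open>fact (card U + 1) \<le> 3\<close> by (force simp: fact_numeral not_le[symmetric])
        qed
        then have "card U = 1" using \<open>1 \<le> card U\<close> by simp
        then obtain u where "U = {u}" by (auto simp: card_1_singleton_iff)
        then show ?thesis using U3 by simp
      qed
      then show ?thesis using disj by blast
    qed
    moreover obtain q r s where qrs: "V = {q, r, s}" "q < r" "r < s" using three_sorted[OF calculation(1)] .
    ultimately have "M = q * r * s" "3 \<notin> {q, r, s}" by (simp_all add: M_def mult.assoc)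
    then show False
      using nine_tiling_impossible[OF E, of q r s] prm qrs AM k9 n U3 T
      by (simp add: M_def[symmetric] k_def)
  next
    case 2
    then obtain p where T: "T = {p}" by (auto simp: card_1_singleton_iff)
    have p: "prime p" using prm T by simp
    have kV: "k \<le> 3 ^ card V" using free[of p] T by simp
    \<comment> \<open>A prime in \<open>U\<close> makes \<open>k\<close> at least 12, while
      \<open>V\<close> then has at most two primes and provides at most nine divisors.\<close>
    have "U = {}"
    proof (rule ccontr)
      assume U: "U \<noteq> {}"
      then have "1 \<le> card U" using fin by (simp add: Suc_leI card_gt_0_iff)
      then have "card V \<le> 2" using card4 2 by simp
      then have "(3 :: nat) ^ card V \<le> 3 ^ 2" by (intro power_increasing) auto
      moreover have "fact 3 \<le> (fact (card T + card U + 1) :: nat)"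
        using 2 \<open>1 \<le> card U\<close> by (intro fact_mono) simp
      then have "6 \<le> \<Prod>T * \<Prod>U" using factTU by (simp add: fact_numeral)
      moreover have "2 \<le> \<Prod>U"
      proof -
        have "fact 2 \<le> (fact (card U + 1) :: nat)" using \<open>1 \<le> card U\<close> by (intro fact_mono) simp
        moreover have "fact (card U + 1) \<le> \<Prod>U" using prod_ge_fact[of U] fin ge2 by auto
        ultimately show ?thesis by (simp add: fact_numeral)
      qed
      ultimately have "6 * 2 \<le> k" unfolding TUk[symmetric] by (intro mult_le_mono)
      then show False using kV \<open>3 ^ card V \<le> 3 ^ 2\<close> by simp
    qed
    then have kp: "k = p" and np: "n = p * M" and Ap: "A = p * M\<^sup>2" using k n A T by (simp_all add: M_def)
    have pM: "\<not> p dvd M"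
      unfolding M_def by (rule prime_not_dvd_prod) (use T prm fin disj in auto)
    have "k \<le> card {d. d dvd M\<^sup>2 \<and> M \<le> d}"
      unfolding k_def
    proof (rule card_inj_on_le[OF inj_free_side[of p]])
      show "free_side p ` F \<subseteq> {d. d dvd M\<^sup>2 \<and> M \<le> d}"
        using free_side_range(1,2)[OF E p Ap np pM, where g = 0] w_le D.w_le by auto
      show "finite {d. d dvd M\<^sup>2 \<and> M \<le> d}" using pos by (simp add: M_def)
    qed
    then have kV: "2 * k \<le> 3 ^ card V + 1" using upper by linarith
    have "card V = 3"
    proof (rule ccontr)
      assume "card V \<noteq> 3"
      then have "(3 :: nat) ^ card V \<le> 3 ^ 2" using card4 2 by (intro power_increasing) auto
      then show False using kV k6 by simp
    qed
    then obtain q r s where qrs: "V = {q, r, s}" "q < r" "r < s" using three_sorted by blast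
    then have M: "M = q * r * s" by (simp add: M_def mult.assoc)
    have "p \<notin> {q, r, s}" using T disj qrs by auto
    then show False
      using one_prime_tiling_impossible[OF E p, of q r s] prm qrs Ap np kp k6 unfolding M
      by (auto simp: k_def)
  next
    case 3
    obtain Q P where T: "T = {Q, P}" "Q < P" using two_sorted[OF 3] .
    have PQ: "prime P" "prime Q" using prm T by auto
    have prodT: "\<Prod>T = P * Q" using T by simp
    have kV: "k \<le> 2 * 3 ^ card V" using free[of P] T by simp
    have six: "6 \<le> P * Q"
    proof -
      have "2 \<le> Q" "3 \<le> P" using ge2[of Q] T by auto
      then show ?thesis using mult_le_mono[of 3 P 2 Q] by simp
    qed
    \<comment> \<open>A prime in \<open>U\<close> makes \<open>k\<close> at least
      \<open>4! = 24\<close>, against at most six divisors.\<close>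
    have "U = {}"
    proof (rule ccontr)
      assume U: "U \<noteq> {}"
      then have U1: "1 \<le> card U" using fin by (simp add: Suc_leI card_gt_0_iff)
      then have "card V \<le> 1" using card4 3 by simp
      then have "(3 :: nat) ^ card V \<le> 3 ^ 1" by (intro power_increasing) auto
      moreover have "fact 4 \<le> (fact (card T + card U + 1) :: nat)" using 3 U1 by (intro fact_mono) simp
      then have "24 \<le> k" using factTU Tk by (simp add: fact_numeral)
      ultimately show False using kV by simp
    qed
    then have kPQ: "k = P * Q" and nPQ: "n = P * Q * M" and APQ: "A = P * (Q * M\<^sup>2)"
      using k n A prodT by (simp_all add: M_def)
    have "card V = 2"
    proof (rule ccontr)
      assume "card V \<noteq> 2"
      then consider "card V = 0" | "card V = 1" using card4 3 by linarith
      then show False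
      proof cases
        case 1
        then show False using kV k6 by simp
      next
        case 2
        then obtain r where r: "V = {r}" by (auto simp: card_1_singleton_iff)
        have M: "M = r" using r by (simp add: M_def)
        let ?B = "Q * M\<^sup>2"
        have "\<not> P dvd M" unfolding M_def by (rule prime_not_dvd_prod) (use T prm fin disj in auto)
        then have ndvd: "\<not> P dvd ?B"
          using PQ T by (auto simp: prime_dvd_mult_iff prime_dvd_power_iff primes_dvd_imp_eq dest: primes_dvd_imp_eq)
        have r2: "2 \<le> M" using ge2 r M by auto
        have An: "A = M * n" using APQ nPQ by (simp add: power2_eq_square mult_ac)
        \<comment> \<open>There are at most six divisors, just enough for \<open>k = 6\<close>; but
          sides are at least \<open>M > 1\<close>, so the divisor 1 is lost.\<close>
        have "card F \<le> card ({d. d dvd ?B} - {1})"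
        proof (rule card_inj_on_le[OF inj_free_side[of P]])
          show "free_side P ` F \<subseteq> {d. d dvd ?B} - {1}"
          proof (rule image_subsetI)
            fix t assume t: "t \<in> F"
            have "M \<le> free_side P t"
              using free_side_cases[of P t] width_ge[OF An t] D.width_ge[OF An t] by auto
            then show "free_side P t \<in> {d. d dvd ?B} - {1}"
              using free_side_dvd(1)[OF PQ(1) APQ ndvd t] r2 by auto
          qed
          show "finite ({d. d dvd ?B} - {1})" using r2 PQ prime_gt_0_nat by auto
        qed
        also have "\<dots> = card {d. d dvd ?B} - 1" by (simp add: card_Diff_singleton_if)
        finally have count: "card F \<le> card {d. d dvd ?B} - 1" .
        have "card {d. d dvd ?B} \<le> card {d. d dvd Q} * card {d. d dvd M\<^sup>2}"
          by (rule card_divisors_mult_le) (use r2 PQ prime_gt_0_nat in auto)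
        also have "\<dots> \<le> 2 * 3"
          using card_divisors_primepow_le[OF PQ(2), of 1] divM 2
          by (intro mult_le_mono) (auto simp: numeral_2_eq_2)
        finally show False using count k6 by (simp add: k_def)
      qed
    qed
    then obtain r s where rs: "V = {r, s}" "r < s" by (rule two_sorted)
    then have M: "M = r * s" by (simp add: M_def)
    have "P \<notin> {r, s}" "Q \<notin> {r, s}" using T disj rs by auto
    then show False
      using two_prime_tiling_impossible[OF E PQ, of r s] prm rs T(2) APQ nPQ kPQ unfolding M
      by (auto simp: k_def)
  next
    case 4
    then obtain p where p: "p \<in> T" by fastforce
    \<comment> \<open>Three or more primes of \<open>T\<close> force \<open>k >= 24\<close>, while
      at most 12 or 8 divisors are available.\<close>
    consider "card T = 3" "card V \<le> 1" | "card T = 4" "card V = 0" using 4 card4 by linarith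
    then show False
    proof cases
      case 1
      have "(3 :: nat) ^ card V \<le> 3 ^ 1" using 1 by (intro power_increasing) auto
      then have "k \<le> 12" using free[OF p] 1 by simp
      moreover have "fact 4 \<le> (fact (card T + card U + 1) :: nat)" using 1 by (intro fact_mono) simp
      then have "24 \<le> k" using factTU Tk by (simp add: fact_numeral)
      ultimately show False by simp
    next
      case 2
      then have "k \<le> 8" using free[OF p] by simp
      moreover have "fact 4 \<le> (fact (card T + card U + 1) :: nat)" using 2 by (intro fact_mono) simp
      then have "24 \<le> k" using factTU Tk by (simp add: fact_numeral)
      ultimately show False by simp
    qed
  qed
qed

theorem mainTheorem9:
  fixes n :: nat
  assumes "\<exists>ps :: nat list. distinct ps \<and> (\<forall>p\<in>set ps. prime p) \<and>
             length ps \<in> {2, 3, 4} \<and> n = prod_list ps"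
  shows "\<not> (\<exists>P. perfect_mondrian_partition n P)"
proof
  assume "\<exists>P. perfect_mondrian_partition n P"
  then obtain P where P: "perfect_mondrian_partition n P" ..
  obtain ps :: "nat list" where ps: "distinct ps" "\<forall>p\<in>set ps. prime p" "length ps \<in> {2, 3, 4}" "n = prod_list ps"
    using assms by blast
  obtain A \<mu> \<nu> where E: "equal_area_tiling P rect_width rect_height A n n \<mu> \<nu>"
    using perfect_partition_tiling[OF P] .
  have "2 \<le> card P"
    using P by (simp add: perfect_mondrian_partition_def mondrian_partition_def)
  moreover have "n = \<Prod>(set ps)" using ps(1,4) by (simp add: prod.distinct_set_conv_list)
  moreover have "card (set ps) \<le> 4" using ps(1,3) by (auto simp: distinct_card)
  ultimately show False
    using squarefree_tiling_impossible[OF E, of "set ps"] ps(2) by blast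
qed

end
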